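(* Let $\alpha\geq 0$, $\beta>0$, and let $\mathcal{A}$ be a $C^*$-algebra or a real $C^*$-algebra or a JC-algebra, with a unit. If $A$ and $B$ are two positive invertible elements in $\mathcal{A}$ satisfying $A^{\beta}\leq B$, then $$\mathrm{I}\leq \mathrm{II}\leq S_{\alpha,\beta}(A|B)\leq \mathrm{III}\leq \mathrm{V}.$$
   Context: A JC-algebra is a norm-closed Jordan subalgebra of $B(H)_{sa}$, the self-adjoint bounded operators on a complex Hilbert space $H$, with Jordan product $A\circ B=\frac12(AB+BA)$, ordered by the cone of positive operators. In the JC case, products are computed in the ambient $B(H)$ (with $ABA=2(A\circ B)\circ A-A^2\circ B$), and all expressions below belong to $\mathcal{A}$. For self-adjoint elements, $X\leq Y$ means $Y-X$ is positive. Real powers, logarithms and inverses are taken by continuous functional calculus for self-adjoint elements; $1$ is the unit of $\mathcal{A}$. For positive invertible $A,B\in\mathcal{A}$ put $X=A^{-\frac{\beta}{2}}BA^{-\frac{\beta}{2}}$. For real $\alpha,\beta$, the relative operator $(\alpha,\beta)$-entropy is $S_{\alpha,\beta}(A|B)=A^{\frac{\beta}{2}}\left[X^{\alpha}\log X\right]A^{\frac{\beta}{2}}$ and the operator $(\alpha,\beta)$-geometric mean is $A\#_{(\alpha,\beta)}B=A^{\frac{\beta}{2}}X^{\alpha}A^{\frac{\beta}{2}}$. For $\alpha\geq 0$, $\beta>0$ set $$\mathrm{I}=2A^{\frac{\beta}{2}}\left[\left(1-2(1+X)^{-1}\right)X^{\alpha}\right]A^{\frac{\beta}{2}},$$ $$\mathrm{II}=4A\#_{(\alpha,\beta)}B-8A^{\frac{\beta}{2}}\left[X^{\alpha}\left(X^{\frac12}+1\right)^{-1}\right]A^{\frac{\beta}{2}},$$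 $$\mathrm{III}=A\#_{(\alpha+\frac12,\beta)}B-A\#_{(\alpha-\frac12,\beta)}B,$$ $$\mathrm{V}=\tfrac12\left(A\#_{(\alpha+1,\beta)}B-A\#_{(\alpha-1,\beta)}B\right).$$ *)

theory Defs
  imports "HOL-Analysis.Analysis" "HOL-Computational_Algebra.Polynomial"
begin

section \<open>Complex normed spaces and Hilbert spaces\<close>

class complex_normed_vector = real_normed_vector +
  fixes scaleC :: "complex \<Rightarrow> 'a \<Rightarrow> 'a" (infixr "*\<^sub>C" 75)
  assumes scaleC_add_right: "c *\<^sub>C (x + y) = c *\<^sub>C x + c *\<^sub>C y"
    and scaleC_add_left: "(c + d) *\<^sub>C x = c *\<^sub>C x + d *\<^sub>C x"
    and scaleC_scaleC: "c *\<^sub>C d *\<^sub>C x = (c * d) *\<^sub>C x"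
    and scaleR_scaleC: "r *\<^sub>R x = complex_of_real r *\<^sub>C x"
    and norm_scaleC: "norm (c *\<^sub>C x) = cmod c * norm x"

text \<open>The inner product is linear in the first argument.\<close>

class complex_hilbert_space = complex_normed_vector + complete_space +
  fixes cinner :: "'a \<Rightarrow> 'a \<Rightarrow> complex"
  assumes cinner_commute: "cinner x y = cnj (cinner y x)"
    and cinner_add_left: "cinner (x + y) z = cinner x z + cinner y z"
    and cinner_scaleC_left: "cinner (c *\<^sub>C x) y = c * cinner x y"
    and cinner_self: "cinner x x = complex_of_real ((norm x)\<^sup>2)"


section \<open>Complex and real C*-algebras\<close>

text \<open>
  The classes do not include a unit: the unit is a parameter of the notions below, so that
  the same notions apply to an algebra of operators whose unit is not the identity operator.
\<close>

class banach_star_algebra = real_normed_algebra + complete_space +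
  fixes star :: "'a \<Rightarrow> 'a"
  assumes star_star: "star (star x) = x"
    and star_add: "star (x + y) = star x + star y"
    and star_mult: "star (x * y) = star y * star x"
    and star_scaleR: "star (r *\<^sub>R x) = r *\<^sub>R star x"
    and cstar_identity: "norm (star x * x) = (norm x)\<^sup>2"

class cstar_algebra = banach_star_algebra + complex_normed_vector +
  assumes mult_scaleC_left: "(c *\<^sub>C x) * y = c *\<^sub>C (x * y)"
    and mult_scaleC_right: "x * (c *\<^sub>C y) = c *\<^sub>C (x * y)"
    and star_scaleC: "star (c *\<^sub>C x) = cnj c *\<^sub>C star x"

text \<open>
  A real C*-algebra satisfies in addition that \<open>1 + x\<^sup>* x\<close> is invertible in the unitization.
  With the inverse written as \<open>1 + y\<close> this becomes the following condition, which does not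
  mention the unit; if the algebra has a unit, it says that \<open>1 + x\<^sup>* x\<close> is invertible
  in the algebra itself.
\<close>

class real_cstar_algebra = banach_star_algebra +
  assumes one_plus_square_invertible:
    "\<exists>y. star x * x + y + star x * x * y = 0 \<and> star x * x + y + y * (star x * x) = 0"


section \<open>The algebra B(H)\<close>

typedef (overloaded) 'h bop =
  "{T :: 'h::complex_hilbert_space \<Rightarrow>\<^sub>L 'h. \<forall>c x. blinfun_apply T (c *\<^sub>C x) = c *\<^sub>C blinfun_apply T x}"
proof -
  have "c *\<^sub>C 0 = (0 :: 'h)" for c
    using scaleC_add_right[of c "0 :: 'h" 0] by simp
  then show ?thesis by (intro exI[of _ 0]) simp
qed

setup_lifting type_definition_bop

lift_definition bop_apply :: "'h::complex_hilbert_space bop \<Rightarrow> 'h \<Rightarrow> 'h" is blinfun_apply .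

lemma scaleC_zero_right: "c *\<^sub>C 0 = (0 :: 'a::complex_normed_vector)"
  using scaleC_add_right[of c "0 :: 'a" 0] by simp

lemma scaleC_minus_right: "c *\<^sub>C (- x) = - (c *\<^sub>C (x :: 'a::complex_normed_vector))"
  using scaleC_add_right[of c x "- x"] by (simp add: scaleC_zero_right eq_neg_iff_add_eq_0 add.commute)

lemma scaleC_diff_right: "c *\<^sub>C (x - y) = c *\<^sub>C x - c *\<^sub>C (y :: 'a::complex_normed_vector)"
  using scaleC_add_right[of c x "- y"] by (simp add: scaleC_minus_right)

instantiation bop :: (complex_hilbert_space) real_normed_algebra
begin

lift_definition zero_bop :: "'a bop" is 0 by (simp add: scaleC_zero_right)
lift_definition plus_bop :: "'a bop \<Rightarrow> 'a bop \<Rightarrow> 'a bop" is "(+)"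
  by (simp add: blinfun.add_left scaleC_add_right)
lift_definition minus_bop :: "'a bop \<Rightarrow> 'a bop \<Rightarrow> 'a bop" is "(-)"
  by (simp add: blinfun.diff_left scaleC_diff_right)
lift_definition uminus_bop :: "'a bop \<Rightarrow> 'a bop" is uminus
  by (simp add: blinfun.minus_left scaleC_minus_right)
lift_definition scaleR_bop :: "real \<Rightarrow> 'a bop \<Rightarrow> 'a bop" is scaleR
  by (simp add: blinfun.scaleR_left scaleR_scaleC scaleC_scaleC mult.commute)
lift_definition times_bop :: "'a bop \<Rightarrow> 'a bop \<Rightarrow> 'a bop" is blinfun_compose
  by simp
lift_definition norm_bop :: "'a bop \<Rightarrow> real" is norm .

definition dist_bop :: "'a bop \<Rightarrow> 'a bop \<Rightarrow> real" where
  "dist_bop S T = norm (S - T)"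
definition sgn_bop :: "'a bop \<Rightarrow> 'a bop" where
  "sgn_bop T = inverse (norm T) *\<^sub>R T"
definition uniformity_bop :: "('a bop \<times> 'a bop) filter" where
  "uniformity_bop = (INF e\<in>{0 <..}. principal {(S, T). dist S T < e})"
definition open_bop :: "'a bop set \<Rightarrow> bool" where
  "open_bop U = (\<forall>S\<in>U. eventually (\<lambda>(S', T). S' = S \<longrightarrow> T \<in> U) uniformity)"

instance
proof
  fix R S T :: "'a bop" and a b :: real
  show "R + S + T = R + (S + T)" "R + S = S + R" "0 + S = S" "- S + S = 0" "R - S = R + - S"
    "a *\<^sub>R (S + T) = a *\<^sub>R S + a *\<^sub>R T" "(a + b) *\<^sub>R S = a *\<^sub>R S + b *\<^sub>R S"
    "a *\<^sub>R b *\<^sub>R S = (a * b) *\<^sub>R S" "1 *\<^sub>R S = S"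
    by (transfer; simp add: algebra_simps)+
  show "R * S * T = R * (S * T)" by transfer (rule blinfun_eqI, simp)
  show "(R + S) * T = R * T + S * T" "R * (S + T) = R * S + R * T"
    by (transfer; rule blinfun_eqI; simp add: blinfun.bilinear_simps)+
  show "a *\<^sub>R S * T = a *\<^sub>R (S * T)" "S * a *\<^sub>R T = a *\<^sub>R (S * T)"
    by (transfer; rule blinfun_eqI; simp add: blinfun.bilinear_simps)+
  show "norm (S + T) \<le> norm S + norm T" by transfer (rule norm_triangle_ineq)
  show "norm (S * T) \<le> norm S * norm T" by transfer (rule norm_blinfun_compose)
  show "norm (a *\<^sub>R S) = \<bar>a\<bar> * norm S" "(norm S = 0) = (S = 0)" by (transfer; simp)+
qed (simp_all add: dist_bop_def sgn_bop_def uniformity_bop_def open_bop_def)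

end


section \<open>JC-algebras\<close>

definition selfadjoint_op :: "'h::complex_hilbert_space bop \<Rightarrow> bool" where
  "selfadjoint_op T \<longleftrightarrow> (\<forall>x y. cinner (bop_apply T x) y = cinner x (bop_apply T y))"

definition positive_op :: "'h::complex_hilbert_space bop \<Rightarrow> bool" where
  "positive_op T \<longleftrightarrow> (\<forall>x. cinner (bop_apply T x) x \<in> \<real>\<^sub>\<ge>\<^sub>0)"

definition op_le :: "'h::complex_hilbert_space bop \<Rightarrow> 'h bop \<Rightarrow> bool" where
  "op_le S T \<longleftrightarrow> positive_op (T - S)"

definition jordan_prod :: "'a::real_normed_algebra \<Rightarrow> 'a \<Rightarrow> 'a" where
  "jordan_prod a b = (1/2) *\<^sub>R (a * b + b * a)"

definition jc_algebra :: "'h::complex_hilbert_space bop set \<Rightarrow> bool" where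
  "jc_algebra J \<longleftrightarrow> subspace J \<and> closed J \<and> (\<forall>T\<in>J. selfadjoint_op T)
     \<and> (\<forall>S\<in>J. \<forall>T\<in>J. jordan_prod S T \<in> J)"

text \<open>The unit of a JC-algebra need not be the identity operator.\<close>

definition jordan_unit :: "'h::complex_hilbert_space bop set \<Rightarrow> 'h bop \<Rightarrow> bool" where
  "jordan_unit J e \<longleftrightarrow> e \<in> J \<and> (\<forall>T\<in>J. jordan_prod e T = T)"


section \<open>Invertibility, spectrum and order\<close>

definition algebra_unit :: "'a::real_normed_algebra \<Rightarrow> bool" where
  "algebra_unit e \<longleftrightarrow> (\<forall>x. e * x = x \<and> x * e = x)"

text \<open>\<open>U\<close> is the algebra, \<open>e\<close> is its unit; products are computed in the ambient type.\<close>

definition invertible_in :: "'a::real_normed_algebra set \<Rightarrow> 'a \<Rightarrow> 'a \<Rightarrow> bool" where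
  "invertible_in U e a \<longleftrightarrow> (\<exists>b\<in>U. a * b = e \<and> b * a = e)"

definition spectrum :: "'a::cstar_algebra \<Rightarrow> 'a \<Rightarrow> complex set" where
  "spectrum e a = {z. \<not> invertible_in UNIV e (a - z *\<^sub>C e)}"

definition cstar_positive :: "'a::cstar_algebra \<Rightarrow> 'a \<Rightarrow> bool" where
  "cstar_positive e a \<longleftrightarrow> star a = a \<and> spectrum e a \<subseteq> \<real>\<^sub>\<ge>\<^sub>0"

definition cstar_le :: "'a::cstar_algebra \<Rightarrow> 'a \<Rightarrow> 'a \<Rightarrow> bool" where
  "cstar_le e a b \<longleftrightarrow> cstar_positive e (b - a)"

text \<open>
  The spectrum of an element of a real algebra is its spectrum in the complexification: there
  \<open>(a - s)\<^sup>2 + t\<^sup>2 = (a - (s + \<i>t)) (a - (s - \<i>t))\<close>, and for real \<open>a\<close> the two factors, being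
  conjugate to each other, are both invertible or both not invertible.
\<close>

definition real_alg_spectrum :: "'a::real_cstar_algebra \<Rightarrow> 'a \<Rightarrow> complex set" where
  "real_alg_spectrum e a =
     {z. \<not> invertible_in UNIV e
           ((a - Re z *\<^sub>R e) * (a - Re z *\<^sub>R e) + (Im z)\<^sup>2 *\<^sub>R e)}"

definition real_cstar_positive :: "'a::real_cstar_algebra \<Rightarrow> 'a \<Rightarrow> bool" where
  "real_cstar_positive e a \<longleftrightarrow> star a = a \<and> real_alg_spectrum e a \<subseteq> \<real>\<^sub>\<ge>\<^sub>0"

definition real_cstar_le :: "'a::real_cstar_algebra \<Rightarrow> 'a \<Rightarrow> 'a \<Rightarrow> bool" where
  "real_cstar_le e a b \<longleftrightarrow> real_cstar_positive e (b - a)"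


section \<open>Continuous functional calculus for self-adjoint elements\<close>

text \<open>
  In all three kinds of algebras the spectrum of a self-adjoint element is real, so the
  functional calculus only refers to its real points.
\<close>

definition real_spectrum :: "'a::real_normed_algebra set \<Rightarrow> 'a \<Rightarrow> 'a \<Rightarrow> real set" where
  "real_spectrum U e a = {t. \<not> invertible_in U e (a - t *\<^sub>R e)}"

definition poly_at :: "'a::real_normed_algebra \<Rightarrow> real poly \<Rightarrow> 'a \<Rightarrow> 'a" where
  "poly_at e p a = (\<Sum>i\<le>degree p. coeff p i *\<^sub>R (times a ^^ i) e)"

text \<open>
  For \<open>f\<close> continuous on the spectrum of the self-adjoint element \<open>a\<close>, the element \<open>f(a)\<close> is
  the common limit of \<open>p\<^sub>n(a)\<close> for all sequences of polynomials \<open>p\<^sub>n\<close> that converge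
  to \<open>f\<close> uniformly on the spectrum of \<open>a\<close>.
\<close>

definition cfc :: "'a::real_normed_algebra set \<Rightarrow> 'a \<Rightarrow> (real \<Rightarrow> real) \<Rightarrow> 'a \<Rightarrow> 'a" where
  "cfc U e f a = (THE b. \<forall>p :: nat \<Rightarrow> real poly.
     uniform_limit (real_spectrum U e a) (\<lambda>n. poly (p n)) f sequentially
       \<longrightarrow> (\<lambda>n. poly_at e (p n) a) \<longlonglongrightarrow> b)"

definition rpow :: "'a::real_normed_algebra set \<Rightarrow> 'a \<Rightarrow> 'a \<Rightarrow> real \<Rightarrow> 'a" where
  "rpow U e a r = cfc U e (\<lambda>t. t powr r) a"

definition logm :: "'a::real_normed_algebra set \<Rightarrow> 'a \<Rightarrow> 'a \<Rightarrow> 'a" where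
  "logm U e a = cfc U e ln a"

definition invm :: "'a::real_normed_algebra set \<Rightarrow> 'a \<Rightarrow> 'a \<Rightarrow> 'a" where
  "invm U e a = cfc U e inverse a"


section \<open>Entropies and means\<close>

definition relX :: "'a::real_normed_algebra set \<Rightarrow> 'a \<Rightarrow> real \<Rightarrow> 'a \<Rightarrow> 'a \<Rightarrow> 'a" where
  "relX U e \<beta> A B = rpow U e A (- \<beta> / 2) * B * rpow U e A (- \<beta> / 2)"

definition rel_entropy ::
  "'a::real_normed_algebra set \<Rightarrow> 'a \<Rightarrow> real \<Rightarrow> real \<Rightarrow> 'a \<Rightarrow> 'a \<Rightarrow> 'a" where
  "rel_entropy U e \<alpha> \<beta> A B = (let X = relX U e \<beta> A B in
     rpow U e A (\<beta> / 2) * (rpow U e X \<alpha> * logm U e X) * rpow U e A (\<beta> / 2))"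

definition geo_mean ::
  "'a::real_normed_algebra set \<Rightarrow> 'a \<Rightarrow> real \<Rightarrow> real \<Rightarrow> 'a \<Rightarrow> 'a \<Rightarrow> 'a" where
  "geo_mean U e \<alpha> \<beta> A B = (let X = relX U e \<beta> A B in
     rpow U e A (\<beta> / 2) * rpow U e X \<alpha> * rpow U e A (\<beta> / 2))"

definition term_I ::
  "'a::real_normed_algebra set \<Rightarrow> 'a \<Rightarrow> real \<Rightarrow> real \<Rightarrow> 'a \<Rightarrow> 'a \<Rightarrow> 'a" where
  "term_I U e \<alpha> \<beta> A B = (let X = relX U e \<beta> A B in
     2 *\<^sub>R (rpow U e A (\<beta> / 2) * ((e - 2 *\<^sub>R invm U e (e + X)) * rpow U e X \<alpha>)
            * rpow U e A (\<beta> / 2)))"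

definition term_II ::
  "'a::real_normed_algebra set \<Rightarrow> 'a \<Rightarrow> real \<Rightarrow> real \<Rightarrow> 'a \<Rightarrow> 'a \<Rightarrow> 'a" where
  "term_II U e \<alpha> \<beta> A B = (let X = relX U e \<beta> A B in
     4 *\<^sub>R geo_mean U e \<alpha> \<beta> A B
     - 8 *\<^sub>R (rpow U e A (\<beta> / 2) * (rpow U e X \<alpha> * invm U e (rpow U e X (1/2) + e))
              * rpow U e A (\<beta> / 2)))"

definition term_III ::
  "'a::real_normed_algebra set \<Rightarrow> 'a \<Rightarrow> real \<Rightarrow> real \<Rightarrow> 'a \<Rightarrow> 'a \<Rightarrow> 'a" where
  "term_III U e \<alpha> \<beta> A B = geo_mean U e (\<alpha> + 1/2) \<beta> A B - geo_mean U e (\<alpha> - 1/2) \<beta> A B"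

definition term_V ::
  "'a::real_normed_algebra set \<Rightarrow> 'a \<Rightarrow> real \<Rightarrow> real \<Rightarrow> 'a \<Rightarrow> 'a \<Rightarrow> 'a" where
  "term_V U e \<alpha> \<beta> A B = (1/2) *\<^sub>R (geo_mean U e (\<alpha> + 1) \<beta> A B - geo_mean U e (\<alpha> - 1) \<beta> A B)"

end

theory Submission
  imports Defs "HOL-Computational_Algebra.Fundamental_Theorem_Algebra"
begin

text \<open>
  Write \<open>X = A\<^sup>-\<^sup>\<beta>\<^sup>/\<^sup>2 B A\<^sup>-\<^sup>\<beta>\<^sup>/\<^sup>2\<close>. Each of the five terms is \<open>A\<^sup>\<beta>\<^sup>/\<^sup>2 f(X) A\<^sup>\<beta>\<^sup>/\<^sup>2\<close> for a scalar function
  \<open>f\<close>, and \<open>A\<^sup>\<beta> \<le> B\<close> forces \<open>X \<ge> 1\<close>, so the chain follows from scalar inequalities on \<open>[1, \<infinity>)\<close>.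

  The functional calculus needs only a closed real space of selfadjoint elements in which
  \<open>\<parallel>x\<^sup>2\<parallel> = \<parallel>x\<parallel>\<^sup>2\<close> and every \<open>1 + x\<^sup>2\<close> is invertible. That \<open>\<parallel>x\<parallel>\<close> or \<open>-\<parallel>x\<parallel>\<close> lies in the spectrum is
  shown by averaging resolvents over the roots of unity of order \<open>2\<^sup>n\<close>: the average for \<open>x\<close> is the
  resolvent of the power \<open>x\<^bsup>2^n\<^esup>\<close>, and by uniform continuity it hardly changes when \<open>x\<close>
  is replaced by a slightly smaller multiple, whose powers tend to zero.
\<close>

section \<open>Selfadjoint parts of operator algebras\<close>

text \<open>The obstacle is the lack of complex scalars and of products. A real C*-algebra has no
  resolvents at complex points, so a conjugate pair of such points enters as a real quadratic, and
  unimodular numbers enter through the cosines of their angles. A JC-algebra contains the product of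
  two of its elements only when they commute, besides the sandwiches \<open>x * y * x\<close>. The
  usual proof that \<open>d * p * d\<close> is positive, through the factor
  \<open>p^(1/2) d\<close>, therefore leaves the space. It is replaced by a deformation of
  \<open>d\<close> to the unit and by the norm criterion \<open>spectrum_nonneg_iff\<close>, which
  makes positivity a closed condition. The scalar functions come from two bounds for the logarithm.
  Apart from the factor \<open>t powr \<alpha>\<close>, term I is the lower bound
  \<open>2 * (t - 1) / (t + 1)\<close> of \<open>ln t\<close>, and II is twice its value at
  \<open>sqrt t\<close>; likewise V is the upper bound \<open>(t - 1 / t) / 2\<close>, and III is
  twice its value at \<open>sqrt t\<close>.\<close>

lemma funpow_times_commute:
  fixes a e :: "'a::real_normed_algebra"
  assumes "a * e = a" "e * a = a"
  shows "a * (times a ^^ n) e = (times a ^^ n) e * a"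
proof (induction n)
  case (Suc n)
  then show ?case by (simp add: mult.assoc) (simp flip: mult.assoc add: Suc)
qed (simp add: assms)

text \<open>The partial sums lie in the closed subspace \<open>T\<close>, hence so does the inverse.
  This keeps inverses inside a JC-algebra; \<open>T\<close> is later the whole type, a selfadjoint
  part or a JC-algebra.\<close>

lemma neumann_series:
  fixes n e :: "'a::{real_normed_algebra,banach}"
  assumes unit: "e * e = e" "n * e = n" "e * n = n" and small: "norm n < 1"
    and T: "subspace T" "closed T" "\<And>k. (times n ^^ k) e \<in> T"
  shows "\<exists>y\<in>T. (e - n) * y = e \<and> y * (e - n) = e"
proof -
  define g where "g k = (times n ^^ k) e" for k
  have le: "norm (g k) \<le> norm e * norm n ^ k" for k
    unfolding g_def
  proof (induction k)
    case (Suc k)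
    have "norm (n * (times n ^^ k) e) \<le> norm n * (norm e * norm n ^ k)"
      by (rule order_trans[OF norm_mult_ineq mult_left_mono[OF Suc]]) simp
    then show ?case by (simp add: mult_ac)
  qed simp
  have "summable (\<lambda>k. norm e * norm n ^ k)"
    using small by (intro summable_mult summable_geometric) simp
  then have "summable g"
    by (rule summable_comparison_test'[where N=0]) (rule le)
  then have sums: "g sums suminf g"
    by (rule summable_sums)
  define y where "y = suminf g"
  have y: "y \<in> T"
    unfolding y_def
    by (rule closed_sequentially[OF T(2) _ sums[unfolded sums_def]])
      (auto intro!: subspace_sum[OF T(1)] simp: g_def T(3))
  \<comment> \<open>Powers of \<open>n\<close> commute with \<open>n\<close>, so one series gives
    the left and the right inverse.\<close>
  have g0: "g 0 = e" and gS: "g (Suc k) = n * g k" "g (Suc k) = g k * n" for k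
    using funpow_times_commute[of n e k] unit by (simp_all add: g_def)
  have ge: "e * g k = g k" "g k * e = g k" for k
  proof (induction k)
    case (Suc k)
    show "e * g (Suc k) = g (Suc k)" by (simp add: gS(1) unit mult.assoc[symmetric])
    show "g (Suc k) * e = g (Suc k)" by (simp add: gS(2) unit mult.assoc)
  qed (simp_all add: g0 unit)
  have shift: "(\<lambda>k. g (Suc k)) sums (y - e)"
    using sums unfolding y_def by (subst sums_Suc_iff) (simp add: g0)
  have "n * y = y - e"
    using sums_unique2[OF sums_mult[OF sums, of n] shift[unfolded gS(1)]] by (simp add: y_def)
  moreover have "y * n = y - e"
    using sums_unique2[OF sums_mult2[OF sums, of n] shift[unfolded gS(2)]] by (simp add: y_def)
  moreover have "e * y = y"
    using sums_unique2[OF sums_mult[OF sums, of e, unfolded ge] sums] by (simp add: y_def)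
  moreover have "y * e = y"
    using sums_unique2[OF sums_mult2[OF sums, of e, unfolded ge] sums] by (simp add: y_def)
  ultimately show ?thesis
    by (intro bexI[OF _ y]) (simp add: algebra_simps)
qed

section \<open>Evaluating real polynomials at an element\<close>

lemma poly_at_eq_sum:
  fixes a e :: "'a::real_normed_algebra"
  assumes "degree p \<le> n"
  shows "poly_at e p a = (\<Sum>i\<le>n. coeff p i *\<^sub>R (times a ^^ i) e)"
  unfolding poly_at_def using assms
  by (intro sum.mono_neutral_left) (auto simp: coeff_eq_0)

lemma poly_at_0 [simp]: "poly_at e 0 a = 0"
  by (simp add: poly_at_def)

lemma poly_at_pCons: "poly_at e (pCons c p) a = c *\<^sub>R e + a * poly_at e p a"
proof -
  have "poly_at e (pCons c p) a = (\<Sum>i\<le>Suc (degree p). coeff (pCons c p) i *\<^sub>R (times a ^^ i) e)"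
    by (rule poly_at_eq_sum) (simp add: degree_pCons_le)
  also have "\<dots> = c *\<^sub>R e + a * poly_at e p a"
    by (simp add: sum.atMost_Suc_shift poly_at_def sum_distrib_left del: sum.atMost_Suc)
  finally show ?thesis .
qed

lemma poly_at_add: "poly_at e (p + q) a = poly_at e p a + poly_at e q a"
  by (subst (1 2 3) poly_at_eq_sum[where n="max (degree p) (degree q)"])
    (auto intro: degree_add_le simp: sum.distrib scaleR_add_left)

lemma poly_at_smult: "poly_at e (smult c p) a = c *\<^sub>R poly_at e p a"
  by (subst (1 2) poly_at_eq_sum[where n="degree p"])
    (auto simp: scaleR_sum_right degree_smult_le)

lemma poly_at_diff: "poly_at e (p - q) a = poly_at e p a - poly_at e q a"
  using poly_at_add[of e "p - q" q a] by simp

lemma poly_at_mult: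
  assumes "\<And>r. e * poly_at e r a = poly_at e r a"
  shows "poly_at e (p * q) a = poly_at e p a * poly_at e q a"
  by (induction p)
    (simp_all add: poly_at_pCons poly_at_add poly_at_smult assms distrib_right mult.assoc)

text \<open>\<open>S\<close> is the selfadjoint part and \<open>U\<close> is where inverses are
  sought; \<open>inverse_S\<close> brings them back to \<open>S\<close>. The products allowed by
  \<open>mult_S\<close> and \<open>sandwich_S\<close> are Jordan expressions: for commuting factors
  \<open>x * y\<close> is the Jordan product, and \<open>x * y * x\<close> is
  \<open>2 (x o y) o x - x^2 o y\<close>. The axiom on \<open>e + x * x\<close> encodes that
  selfadjoint elements have real spectrum.\<close>

locale sa_algebra =
  fixes S U :: "'a::{real_normed_algebra,banach} set" and e :: 'a
  assumes subspace_S: "subspace S" and closed_S: "closed S" and S_U: "S \<subseteq> U"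
    and e_S [simp]: "e \<in> S"
    and e_left [simp]: "x \<in> S \<Longrightarrow> e * x = x" and e_right [simp]: "x \<in> S \<Longrightarrow> x * e = x"
    and mult_S: "x \<in> S \<Longrightarrow> y \<in> S \<Longrightarrow> x * y = y * x \<Longrightarrow> x * y \<in> S"
    and sandwich_S: "x \<in> S \<Longrightarrow> y \<in> S \<Longrightarrow> x * y * x \<in> S"
    and inverse_S: "x \<in> S \<Longrightarrow> b \<in> U \<Longrightarrow> x * b = e \<Longrightarrow> b * x = e \<Longrightarrow> b \<in> S"
    and norm_square: "x \<in> S \<Longrightarrow> norm (x * x) = (norm x)\<^sup>2"
    and one_plus_square_inv: "x \<in> S \<Longrightarrow> invertible_in U e (e + x * x)"
begin

lemma S_closed [simp]:
  "0 \<in> S" "x \<in> S \<Longrightarrow> y \<in> S \<Longrightarrow> x + y \<in> S" "x \<in> S \<Longrightarrow> y \<in> S \<Longrightarrow> x - y \<in> S"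
  "x \<in> S \<Longrightarrow> c *\<^sub>R x \<in> S" "x \<in> S \<Longrightarrow> - x \<in> S" "x \<in> S \<Longrightarrow> x * x \<in> S"
  using subspace_S by (auto simp: subspace_0 subspace_add subspace_diff subspace_scale subspace_neg mult_S)

lemma e_left_assoc [simp]: "x \<in> S \<Longrightarrow> x * (e * y) = x * y"
  by (simp add: mult.assoc[symmetric])

lemma e_left_assoc' [simp]: "x \<in> S \<Longrightarrow> e * (x * y) = x * y"
  by (simp add: mult.assoc[symmetric])

text \<open>Idempotence only gives norm 0 or 1: the zero algebra, where \<open>e = 0\<close>, is not
  excluded.\<close>

lemma norm_e: "norm e \<le> 1"
proof -
  have "norm e = (norm e)\<^sup>2" using norm_square[OF e_S] by simp
  then show ?thesis by (cases "norm e = 0") (auto simp: power2_eq_square)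
qed

lemma invertible_inE:
  assumes "invertible_in U e x" "x \<in> S"
  obtains y where "y \<in> S" "x * y = e" "y * x = e"
  using assms inverse_S unfolding invertible_in_def by metis

lemma invertible_inI: "y \<in> S \<Longrightarrow> x * y = e \<Longrightarrow> y * x = e \<Longrightarrow> invertible_in U e x"
  using S_U unfolding invertible_in_def by auto

lemma inverse_commute:
  assumes "x \<in> S" "y \<in> S" "x * y = e" "y * x = e" "z \<in> S" "x * z = z * x"
  shows "y * z = z * y"
proof -
  have "y * z = y * (z * x) * y" using assms by (simp add: mult.assoc)
  also have "\<dots> = z * y" using assms by (simp add: assms(6)[symmetric] mult.assoc[symmetric])
  finally show ?thesis .
qed

lemma inverse_unique:
  assumes "x \<in> S" "y \<in> S" "x * y = e" "z \<in> S" "z * x = e"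
  shows "y = z"
proof -
  have "y = (z * x) * y" using assms by simp
  also have "\<dots> = z" using assms(1-4) by (simp only: mult.assoc e_right)
  finally show ?thesis .
qed

lemma invertible_in_mult:
  assumes "x \<in> S" "y \<in> S" "x * y = y * x" "invertible_in U e x" "invertible_in U e y"
  shows "invertible_in U e (x * y)"
proof -
  obtain x' where x': "x' \<in> S" "x * x' = e" "x' * x = e" using invertible_inE assms by metis
  obtain y' where y': "y' \<in> S" "y * y' = e" "y' * y = e" using invertible_inE assms by metis
  have "y' * x = x * y'" using inverse_commute[of y y' x] assms y' by simp
  then have "x' * y' = y' * x'" using inverse_commute[of x x' y'] assms x' y' by simp
  then have "y' * x' \<in> S" using mult_S x' y' by metis
  moreover have "x * y * (y' * x') = x * (y * y') * x'" "y' * x' * (x * y) = y' * (x' * x) * y"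
    by (simp_all add: mult.assoc)
  ultimately show ?thesis
    by (intro invertible_inI[of "y' * x'"]) (simp_all add: x' y' assms)
qed

lemma invertible_in_factor:
  assumes "x \<in> S" "y \<in> S" "x * y = y * x" "invertible_in U e (x * y)"
  shows "invertible_in U e x"
proof -
  have xy: "x * y \<in> S" using assms mult_S by simp
  obtain z where z: "z \<in> S" "x * y * z = e" "z * (x * y) = e" using invertible_inE[OF assms(4) xy] by metis
  have "z * y = y * z"
    by (rule inverse_commute[OF xy z(1-3) assms(2)]) (simp add: assms(3) mult.assoc)
  then have "y * z \<in> S" using mult_S z assms by metis
  then show ?thesis
    using z \<open>z * y = y * z\<close>
    by (intro invertible_inI[of "y * z"]) (metis mult.assoc assms(3))+
qed

lemma invertible_in_scaleR:
  assumes "x \<in> S" "invertible_in U e x" "c \<noteq> 0"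
  shows "invertible_in U e (c *\<^sub>R x)"
proof -
  obtain y where "y \<in> S" "x * y = e" "y * x = e" using invertible_inE assms by metis
  then show ?thesis using assms by (intro invertible_inI[of "inverse c *\<^sub>R y"]) auto
qed

lemma invertible_in_scaleR_iff:
  assumes "x \<in> S" "c \<noteq> 0"
  shows "invertible_in U e (c *\<^sub>R x) \<longleftrightarrow> invertible_in U e x"
  using invertible_in_scaleR[of x c] invertible_in_scaleR[of "c *\<^sub>R x" "inverse c"] assms by auto

text \<open>Over the complex numbers the factors are \<open>a - (s + \<i> r)\<close> and
  \<open>a - (s - \<i> r)\<close>, so this says in real terms that non-real numbers are not in the
  spectrum.\<close>

lemma invertible_in_quadratic:
  assumes "a \<in> S" "r \<noteq> 0"
  shows "invertible_in U e ((a - s *\<^sub>R e) * (a - s *\<^sub>R e) + r\<^sup>2 *\<^sub>R e)"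
proof -
  let ?x = "(1/r) *\<^sub>R (a - s *\<^sub>R e)"
  have x: "?x \<in> S" using assms by simp
  have "invertible_in U e (r\<^sup>2 *\<^sub>R (e + ?x * ?x))"
    using assms x by (intro invertible_in_scaleR one_plus_square_inv S_closed e_S) simp_all
  moreover have "r\<^sup>2 *\<^sub>R (e + ?x * ?x) = (a - s *\<^sub>R e) * (a - s *\<^sub>R e) + r\<^sup>2 *\<^sub>R e"
    using assms by (simp add: scaleR_add_right power2_eq_square)
  ultimately show ?thesis by simp
qed

lemma funpow_times_S: "a \<in> S \<Longrightarrow> (times a ^^ k) e \<in> S"
proof (induction k)
  case (Suc k)
  then show ?case using mult_S[of a "(times a ^^ k) e"] funpow_times_commute[of a e k] by simp
qed simp

lemma neumann_S:
  assumes "n \<in> S" "norm n < 1"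
  shows "invertible_in U e (e - n)"
proof -
  have "\<exists>y\<in>S. (e - n) * y = e \<and> y * (e - n) = e"
    using assms by (intro neumann_series funpow_times_S subspace_S closed_S) simp_all
  then show ?thesis using invertible_inI by blast
qed

lemma poly_at_S: "a \<in> S \<Longrightarrow> poly_at e p a \<in> S"
  unfolding poly_at_def by (rule subspace_sum[OF subspace_S]) (simp add: funpow_times_S)

lemma poly_at_mult_S: "a \<in> S \<Longrightarrow> poly_at e (p * q) a = poly_at e p a * poly_at e q a"
  by (intro poly_at_mult) (simp add: poly_at_S)

lemma poly_at_commute: "a \<in> S \<Longrightarrow> poly_at e p a * poly_at e q a = poly_at e q a * poly_at e p a"
  using poly_at_mult_S[of a p q] poly_at_mult_S[of a q p] by (simp only: mult.commute[of q p])

end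

section \<open>The spectral radius of a selfadjoint element\<close>

lemma sum_lessThan_double:
  fixes f :: "nat \<Rightarrow> 'b::comm_monoid_add"
  shows "(\<Sum>j<m + m. f j) = (\<Sum>j<m. f j) + (\<Sum>j<m. f (j + m))"
  using sum.atLeastLessThan_concat[of 0 m "m + m" f] sum.shift_bounds_nat_ivl[of f 0 m m]
  by (simp add: atLeast0LessThan)

context sa_algebra
begin

text \<open>\<open>invm\<close> is defined through the functional calculus, which rests on the
  spectral radius; this inverse serves until then.\<close>

definition sinv :: "'a \<Rightarrow> 'a" where
  "sinv x = (THE y. y \<in> S \<and> x * y = e \<and> y * x = e)"

lemma sinv_eqI:
  assumes "x \<in> S" "y \<in> S" "x * y = e" "y * x = e"
  shows "sinv x = y"
  unfolding sinv_def using assms inverse_unique by (intro the_equality) auto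

lemma sinv:
  assumes "x \<in> S" "invertible_in U e x"
  shows "sinv x \<in> S" "x * sinv x = e" "sinv x * x = e"
  using assms sinv_eqI by (metis invertible_inE)+

lemma sinv_commute:
  assumes "x \<in> S" "invertible_in U e x" "z \<in> S" "x * z = z * x"
  shows "sinv x * z = z * sinv x"
  using inverse_commute[of x "sinv x" z] sinv assms by simp

lemma sinv_mult:
  assumes "x \<in> S" "y \<in> S" "x * y = y * x" "invertible_in U e x" "invertible_in U e y"
  shows "sinv (x * y) = sinv x * sinv y"
proof (rule sinv_eqI)
  note sx = sinv[OF assms(1,4)] and sy = sinv[OF assms(2,5)]
  have 1: "sinv y * x = x * sinv y" using assms by (intro sinv_commute) simp_all
  have 2: "sinv x * sinv y = sinv y * sinv x" using assms 1 sy by (intro sinv_commute) simp_all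
  show "x * y \<in> S" using assms mult_S by simp
  show "sinv x * sinv y \<in> S" using 2 mult_S sx sy by simp
  have "x * y * (sinv x * sinv y) = x * (y * sinv y) * sinv x" by (simp add: 2 mult.assoc)
  then show "x * y * (sinv x * sinv y) = e" using sx sy assms by simp
  have "sinv x * sinv y * (x * y) = sinv y * (sinv x * x) * y" by (simp only: 2 mult.assoc)
  then show "sinv x * sinv y * (x * y) = e" using sx sy assms by simp
qed

text \<open>The resolvent identity expresses the difference of the inverses as
  \<open>sinv x' * (x - x') * sinv x\<close>. The unknown norm of \<open>sinv x'\<close> is at most
  that of \<open>sinv x\<close> plus the difference itself.\<close>

lemma continuous_on_sinv: "continuous_on {x \<in> S. invertible_in U e x} sinv"
  unfolding continuous_on_iff
proof (intro ballI allI impI)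
  fix x and \<epsilon> :: real
  assume "x \<in> {x \<in> S. invertible_in U e x}" and \<epsilon>: "\<epsilon> > 0"
  then have x: "x \<in> S" "invertible_in U e x" by auto
  define K where "K = norm (sinv x) + 1"
  \<comment> \<open>The first bound allows half of the difference to be absorbed on the left, the
    second brings the rest below \<open>\<epsilon>\<close>.\<close>
  define \<delta> where "\<delta> = min (1 / (2 * K)) (\<epsilon> / (2 * K * K))"
  have K: "K \<ge> 1" by (simp add: K_def)
  have \<delta>: "\<delta> > 0" "\<delta> * K \<le> 1/2" "2 * \<delta> * K * K \<le> \<epsilon>"
    using K \<epsilon> by (auto simp: \<delta>_def min_def field_simps)
  show "\<exists>d>0. \<forall>x'\<in>{x \<in> S. invertible_in U e x}. dist x' x < d \<longrightarrow> dist (sinv x') (sinv x) < \<epsilon>"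
  proof (intro exI[of _ \<delta>] conjI ballI impI \<delta>(1))
    fix x' assume "x' \<in> {x \<in> S. invertible_in U e x}" and d: "dist x' x < \<delta>"
    then have x': "x' \<in> S" "invertible_in U e x'" by auto
    let ?D = "norm (sinv x' - sinv x)"
    have "sinv x' - sinv x = sinv x' * (x - x') * sinv x"
      using sinv[OF x] sinv[OF x'] by (simp add: right_diff_distrib left_diff_distrib mult.assoc)
    then have "?D \<le> norm (sinv x') * norm (x - x') * norm (sinv x)"
      by (simp only: order_trans[OF norm_mult_ineq mult_right_mono[OF norm_mult_ineq]] norm_ge_zero)
    also have "\<dots> \<le> (norm (sinv x) + ?D) * \<delta> * K"
      using d norm_triangle_sub[of "sinv x'" "sinv x"]
      using \<delta>(1) by (intro mult_mono) (auto simp: K_def dist_norm norm_minus_commute add.commute)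
    also have "\<dots> \<le> \<delta> * K * (norm (sinv x)) + 1/2 * ?D"
      using mult_right_mono[OF \<delta>(2), of ?D] by (simp add: algebra_simps)
    finally have "?D \<le> 2 * \<delta> * K * norm (sinv x)" by simp
    also have "\<dots> < 2 * \<delta> * K * K" using \<delta>(1) K by (intro mult_strict_left_mono) (auto simp: K_def intro!: mult_pos_pos add_nonneg_pos)
    finally show "dist (sinv x') (sinv x) < \<epsilon>" using \<delta>(3) by (simp add: dist_norm)
  qed
qed

text \<open>For a scalar \<open>x\<close>, \<open>QQ x \<theta>\<close> is the squared modulus of \<open>1 - exp (\<i> \<theta>) x\<close>
  and \<open>CC x \<theta>\<close> is the real part of its inverse.\<close>

definition QQ :: "'a \<Rightarrow> real \<Rightarrow> 'a" where
  "QQ x \<theta> = e - (2 * cos \<theta>) *\<^sub>R x + x * x"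

definition CC :: "'a \<Rightarrow> real \<Rightarrow> 'a" where
  "CC x \<theta> = (e - cos \<theta> *\<^sub>R x) * sinv (QQ x \<theta>)"

lemma QQ_S [simp]: "x \<in> S \<Longrightarrow> QQ x \<theta> \<in> S"
  by (simp add: QQ_def)

lemma QQ_poly_at: "x \<in> S \<Longrightarrow> QQ x \<theta> = poly_at e [:1, - 2 * cos \<theta>, 1:] x"
  by (simp add: QQ_def poly_at_pCons algebra_simps)

text \<open>Put \<open>z = exp (\<i> \<theta>) x\<close>; adding \<open>pi\<close> to the angle
  gives \<open>- z\<close>. The claims are \<open>|1 - z^2|^2 = |1 - z|^2 |1 + z|^2\<close> and the
  real part of \<open>1 / (1 - z) + 1 / (1 + z) = 2 / (1 - z^2)\<close>. Both reduce to identities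
  between real polynomials in \<open>x\<close>.\<close>

lemma CC_doubling:
  assumes x: "x \<in> S" and inv: "invertible_in U e (QQ x \<theta>)" "invertible_in U e (QQ x (\<theta> + pi))"
  shows "QQ (x * x) (2 * \<theta>) = QQ x \<theta> * QQ x (\<theta> + pi)"
    and "CC x \<theta> + CC x (\<theta> + pi) = 2 *\<^sub>R CC (x * x) (2 * \<theta>)"
proof -
  let ?c = "cos \<theta>"
  let ?p = "[:1, - 2 * ?c, 1:]" and ?q = "[:1, 2 * ?c, 1:]"
  have Q: "QQ x \<theta> = poly_at e ?p x" "QQ x (\<theta> + pi) = poly_at e ?q x"
    using QQ_poly_at[OF x, of \<theta>] QQ_poly_at[OF x, of "\<theta> + pi"] by simp_all
  have "QQ (x * x) (2 * \<theta>) = poly_at e [:1, 0, - 2 * cos (2 * \<theta>), 0, 1:] x"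
    using x by (simp add: QQ_def poly_at_pCons algebra_simps)
  also have "[:1, 0, - 2 * cos (2 * \<theta>), 0, 1:] = ?p * ?q"
    by (simp add: cos_double_cos power2_eq_square)
  finally show QQ: "QQ (x * x) (2 * \<theta>) = QQ x \<theta> * QQ x (\<theta> + pi)"
    using x by (simp only: Q poly_at_mult_S)
  have com: "QQ x \<theta> * QQ x (\<theta> + pi) = QQ x (\<theta> + pi) * QQ x \<theta>"
    unfolding Q by (rule poly_at_commute[OF x])
  define P R where "P = sinv (QQ x \<theta>)" and "R = sinv (QQ x (\<theta> + pi))"
  have P: "P \<in> S" "QQ x \<theta> * P = e" and R: "R \<in> S" "QQ x (\<theta> + pi) * R = e" and
    PR: "sinv (QQ (x * x) (2 * \<theta>)) = P * R"
    unfolding P_def R_def QQ using sinv[OF _ inv(1)] sinv[OF _ inv(2)] x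
    by (simp_all add: sinv_mult[OF _ _ com inv])
  have P2: "QQ x (\<theta> + pi) * P = P * QQ x (\<theta> + pi)"
    unfolding P_def using sinv_commute[OF _ inv(1) _ com] x by simp
  let ?l = "[:1, - ?c:]" and ?m = "[:1, ?c:]"
  have lm: "e - ?c *\<^sub>R x = poly_at e ?l x" "e + ?c *\<^sub>R x = poly_at e ?m x"
    using x by (simp_all add: poly_at_pCons)
  \<comment> \<open>Both fractions are brought to the common denominator, whose inverse is
    \<open>P * R\<close>.\<close>
  have P_eq: "P = QQ x (\<theta> + pi) * (P * R)" and R_eq: "R = QQ x \<theta> * (P * R)"
    using P R x by (simp_all add: P2 mult.assoc[symmetric])
      (metis P2 R(2) e_right mult.assoc)
  have "CC x \<theta> + CC x (\<theta> + pi) = poly_at e ?l x * P + poly_at e ?m x * R"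
    by (simp add: CC_def lm P_def R_def)
  also have "\<dots> = (poly_at e ?l x * QQ x (\<theta> + pi) + poly_at e ?m x * QQ x \<theta>) * (P * R)"
    by (subst P_eq, subst R_eq) (simp only: distrib_right mult.assoc)
  also have "poly_at e ?l x * QQ x (\<theta> + pi) + poly_at e ?m x * QQ x \<theta> = poly_at e (?l * ?q + ?m * ?p) x"
    using x by (simp only: Q poly_at_mult_S poly_at_add)
  also have "?l * ?q + ?m * ?p = smult 2 [:1, 0, - cos (2 * \<theta>):]"
    by (simp add: cos_double_cos power2_eq_square)
  also have "poly_at e \<dots> x = 2 *\<^sub>R (e - cos (2 * \<theta>) *\<^sub>R (x * x))"
    using x by (simp add: poly_at_smult poly_at_pCons algebra_simps)
  finally show "CC x \<theta> + CC x (\<theta> + pi) = 2 *\<^sub>R CC (x * x) (2 * \<theta>)"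
    by (simp add: CC_def PR)
qed

lemma iterated_square_S: "x \<in> S \<Longrightarrow> ((\<lambda>y. y * y) ^^ k) x \<in> S"
  by (induction k) simp_all

lemma norm_iterated_square: "x \<in> S \<Longrightarrow> norm (((\<lambda>y. y * y) ^^ k) x) = norm x ^ (2 ^ k)"
  by (induction k) (simp_all add: norm_square iterated_square_S power_mult[symmetric] mult.commute)

lemma QQ_square_inv:
  assumes x: "x \<in> S" and inv: "\<And>\<theta>. invertible_in U e (QQ x \<theta>)"
  shows "invertible_in U e (QQ (x * x) \<theta>)"
proof -
  have "QQ (x * x) (2 * (\<theta> / 2)) = QQ x (\<theta> / 2) * QQ x (\<theta> / 2 + pi)"
    by (rule CC_doubling(1)[OF x inv inv])
  moreover have "invertible_in U e (QQ x (\<theta> / 2) * QQ x (\<theta> / 2 + pi))"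
    using x by (intro invertible_in_mult inv) (simp_all only: QQ_S, simp only: QQ_poly_at poly_at_commute)
  ultimately show ?thesis by simp
qed

lemma QQ_iterated_square_inv:
  assumes "x \<in> S" "\<And>\<theta>. invertible_in U e (QQ x \<theta>)"
  shows "invertible_in U e (QQ (((\<lambda>y. y * y) ^^ k) x) \<theta>)"
  by (induction k arbitrary: \<theta>) (simp_all add: assms QQ_square_inv iterated_square_S)

text \<open>The angles are those of the \<open>2^k\<close>-th roots of
  \<open>exp (\<i> \<theta>)\<close>. In the induction step, \<open>j\<close> and
  \<open>j + 2^k\<close> have angles that differ by \<open>pi\<close>, and the doubling formula
  turns each pair into twice a term of \<open>x * x\<close>.\<close>

lemma CC_average:
  assumes "x \<in> S" "\<And>\<theta>. invertible_in U e (QQ x \<theta>)"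
  shows "(\<Sum>j<2^k. CC x ((\<theta> + 2 * pi * real j) / 2 ^ k)) = 2 ^ k *\<^sub>R CC (((\<lambda>y. y * y) ^^ k) x) \<theta>"
  using assms
proof (induction k arbitrary: x)
  case (Suc k)
  have inv2: "invertible_in U e (QQ (x * x) \<theta>)" for \<theta>
    by (rule QQ_square_inv[OF Suc.prems])
  let ?f = "\<lambda>j. CC x ((\<theta> + 2 * pi * real j) / 2 ^ Suc k)"
  have shift: "?f (j + 2 ^ k) = CC x ((\<theta> + 2 * pi * real j) / 2 ^ Suc k + pi)" for j
    by (simp add: field_simps)
  have "(\<Sum>j<2^Suc k. ?f j) = (\<Sum>j<2^k. ?f j) + (\<Sum>j<2^k. ?f (j + 2 ^ k))"
    by (simp only: power_Suc mult_2 sum_lessThan_double)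
  also have "\<dots> = (\<Sum>j<2^k. 2 *\<^sub>R CC (x * x) ((\<theta> + 2 * pi * real j) / 2 ^ k))"
    unfolding sum.distrib[symmetric] shift
    by (intro sum.cong refl) (subst CC_doubling(2), simp_all only: Suc.prems power_Suc
      times_divide_eq_right mult_divide_mult_cancel_left_if, simp)
  also have "\<dots> = 2 ^ Suc k *\<^sub>R CC (((\<lambda>y. y * y) ^^ k) (x * x)) \<theta>"
    using Suc.IH[of "x * x"] Suc.prems inv2 by (simp add: scaleR_sum_right[symmetric])
  also have "((\<lambda>y. y * y) ^^ k) (x * x) = ((\<lambda>y. y * y) ^^ Suc k) x"
    by (simp only: funpow_Suc_right o_apply)
  finally show ?case .
qed simp

text \<open>At angle 0 \<open>QQ\<close> is the square of \<open>e - y\<close>, so \<open>CC\<close>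
  is a genuine resolvent. The second equation stands in for membership of \<open>CC y 0\<close> in
  \<open>S\<close>, where \<open>e\<close> is known to act as a unit.\<close>

lemma CC_0:
  assumes y: "y \<in> S" and inv: "invertible_in U e (QQ y 0)"
  shows "(e - y) * CC y 0 = e" "e * CC y 0 = CC y 0"
proof -
  have "QQ y 0 = (e - y) * (e - y)"
    using y by (simp add: QQ_def algebra_simps scaleR_2)
  then show "(e - y) * CC y 0 = e"
    using sinv(2)[OF QQ_S[OF y] inv] by (simp add: CC_def mult.assoc[symmetric])
  show "e * CC y 0 = CC y 0"
    using y by (simp add: CC_def)
qed

text \<open>If \<open>sin \<theta> = 0\<close>, the element is the square of
  \<open>e - s *\<^sub>R x\<close> with \<open>\<bar>s\<bar> \<le> 1\<close>: the Neumann series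
  covers \<open>\<bar>s\<bar> < 1\<close>, and the hypotheses cover the endpoints. For all other
  angles the quadratic has non-real roots.\<close>

lemma QQ_scaled_inv:
  assumes x: "x \<in> S" "norm x = 1" and inv: "invertible_in U e (e - x)" "invertible_in U e (e + x)"
    and t: "0 \<le> t" "t \<le> 1"
  shows "invertible_in U e (QQ (t *\<^sub>R x) \<theta>)"
proof (cases "sin \<theta> = 0")
  case True
  then have c: "(cos \<theta>)\<^sup>2 = 1" using sin_cos_squared_add[of \<theta>] by simp
  define s where "s = t * cos \<theta>"
  have two: "(2 * s) *\<^sub>R x = s *\<^sub>R x + s *\<^sub>R x" by (simp add: scaleR_add_left[symmetric])
  have s: "\<bar>s\<bar> \<le> 1"
    using t abs_cos_le_one[of \<theta>] by (auto simp: s_def abs_mult intro: mult_le_one)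
  have "invertible_in U e (e - s *\<^sub>R x)"
  proof (cases "\<bar>s\<bar> < 1")
    case True
    then show ?thesis using x by (intro neumann_S) simp_all
  next
    case False
    then have "s = 1 \<or> s = - 1" using s by auto
    then show ?thesis using inv by auto
  qed
  then have "invertible_in U e ((e - s *\<^sub>R x) * (e - s *\<^sub>R x))"
    using x by (intro invertible_in_mult) simp_all
  also have "(e - s *\<^sub>R x) * (e - s *\<^sub>R x) = e - (2 * s) *\<^sub>R x + (s * s) *\<^sub>R (x * x)"
    unfolding two using x by (simp add: algebra_simps)
  also have "s * s = t * t"
    using c by (simp add: s_def power2_eq_square)
  finally show ?thesis by (simp add: QQ_def s_def mult_ac)
next
  case False
  show ?thesis
  proof (cases "t = 0")
    case True
    then show ?thesis by (intro invertible_inI[of e]) (simp_all add: QQ_def)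
  next
    case False
    \<comment> \<open>\<open>u + \<i> r\<close> and \<open>u - \<i> r\<close> are the zeros of
      \<open>1 - 2 t cos \<theta> x + t^2 x^2\<close>.\<close>
    define u r where "u = cos \<theta> / t" and "r = sin \<theta> / t"
    have ur: "t * u = cos \<theta>" "t * t * (u * u + r * r) = 1" and r: "r \<noteq> 0"
      using False \<open>sin \<theta> \<noteq> 0\<close> sin_cos_squared_add3[of \<theta>]
      by (simp_all add: u_def r_def field_simps power2_eq_square)
    have two: "(2 * t * (t * u)) *\<^sub>R x = (t * (t * u)) *\<^sub>R x + (t * (t * u)) *\<^sub>R x"
      by (simp add: scaleR_add_left[symmetric])
    have "invertible_in U e ((t * t) *\<^sub>R ((x - u *\<^sub>R e) * (x - u *\<^sub>R e) + r\<^sup>2 *\<^sub>R e))"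
      using x r False by (intro invertible_in_scaleR invertible_in_quadratic) simp_all
    also have "(t * t) *\<^sub>R ((x - u *\<^sub>R e) * (x - u *\<^sub>R e) + r\<^sup>2 *\<^sub>R e) =
      (t * t * (u * u + r * r)) *\<^sub>R e - (2 * t * (t * u)) *\<^sub>R x + (t * t) *\<^sub>R (x * x)"
      unfolding two using x by (simp add: algebra_simps power2_eq_square)
    finally have "invertible_in U e (e - (2 * t * cos \<theta>) *\<^sub>R x + (t * t) *\<^sub>R (x * x))"
      by (simp only: ur scaleR_one)
    then show ?thesis by (simp add: QQ_def mult_ac)
  qed
qed

text \<open>If both inverses existed, \<open>G 1\<close> would be within 1/4 of \<open>e\<close>.
  But it inverts \<open>e - y 1\<close> with \<open>norm (y 1) = 1\<close>, whereas
  \<open>y 1 = (e - y 1) * (G 1 - e)\<close> would then have norm at most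
  \<open>2 * (1/4)\<close>.\<close>

lemma norm_one_not_invertible:
  assumes x: "x \<in> S" "norm x = 1"
  shows "\<not> (invertible_in U e (e - x) \<and> invertible_in U e (e + x))"
proof
  assume "invertible_in U e (e - x) \<and> invertible_in U e (e + x)"
  then have inv: "invertible_in U e (QQ (t *\<^sub>R x) \<theta>)" if "0 \<le> t" "t \<le> 1" for t \<theta>
    using QQ_scaled_inv x that by blast
  have tx: "t *\<^sub>R x \<in> S" for t using x by simp
  let ?D = "{0..1::real} \<times> {0..2 * pi}"
  have "continuous_on ?D (\<lambda>p. sinv (QQ (fst p *\<^sub>R x) (snd p)))"
    by (rule continuous_on_compose2[OF continuous_on_sinv])
      (use inv x in \<open>auto simp: QQ_def intro!: continuous_intros\<close>)
  then have "continuous_on ?D (\<lambda>p. CC (fst p *\<^sub>R x) (snd p))"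
    unfolding CC_def by (intro continuous_intros)
  then have "uniformly_continuous_on ?D (\<lambda>p. CC (fst p *\<^sub>R x) (snd p))"
    by (intro compact_uniformly_continuous compact_Times) simp_all
  then obtain \<delta> where \<delta>: "\<delta> > 0" and
    unif: "\<And>p p'. p \<in> ?D \<Longrightarrow> p' \<in> ?D \<Longrightarrow> dist p' p < \<delta> \<Longrightarrow>
      dist (CC (fst p' *\<^sub>R x) (snd p')) (CC (fst p *\<^sub>R x) (snd p)) < 1/8"
    unfolding uniformly_continuous_on_def by (metis zero_less_divide_1_iff zero_less_numeral)
  \<comment> \<open>\<open>t\<close> depends on \<open>\<delta>\<close> only and is fixed before
    \<open>n\<close>; this is possible because the continuity is uniform in the angle, so that
    \<open>close\<close> serves all \<open>2^n\<close> angles for whatever \<open>n\<close>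
    follows.\<close>
  define t where "t = max 0 (1 - \<delta> / 2)"
  have t: "0 \<le> t" "t < 1" "\<bar>t - 1\<bar> < \<delta>" using \<delta> by (auto simp: t_def max_def)
  have close: "norm (CC (t *\<^sub>R x) \<theta> - CC (1 *\<^sub>R x) \<theta>) \<le> 1/8" if "0 \<le> \<theta>" "\<theta> \<le> 2 * pi" for \<theta>
    using unif[of "(1, \<theta>)" "(t, \<theta>)"] t that by (simp add: dist_Pair_Pair dist_norm)
  \<comment> \<open>With 1/9, the estimate \<open>d \<le> 1/9 * (1 + d)\<close> below yields
    \<open>d \<le> 1/8\<close>.\<close>
  obtain n where n: "t ^ n < 1/9" using real_arch_pow_inv[of "1/9" t] t by auto
  define y where "y s = ((\<lambda>y. y * y) ^^ n) (s *\<^sub>R x)" for s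
  define G where "G s = CC (y s) 0" for s
  have y_S: "y s \<in> S" for s using iterated_square_S tx by (simp add: y_def)
  have G: "(e - y s) * G s = e" "e * G s = G s" if "0 \<le> s" "s \<le> 1" for s
    using CC_0[OF y_S[of s]] QQ_iterated_square_inv[OF tx inv, of s n 0] that
    by (simp_all add: y_def G_def)
  have avg: "2 ^ n *\<^sub>R G s = (\<Sum>j<2^n. CC (s *\<^sub>R x) ((0 + 2 * pi * real j) / 2 ^ n))"
    if "0 \<le> s" "s \<le> 1" for s
    using CC_average[OF tx inv, of s 0 n] that by (simp add: G_def y_def)
  have "norm (2 ^ n *\<^sub>R (G t - G 1)) \<le> (\<Sum>j<(2::nat)^n. 1/8)"
    using t unfolding scaleR_diff_right
    by (simp only: avg zero_le_one order_refl less_imp_le sum_subtractf[symmetric])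
      (intro sum_norm_le close, auto simp: field_simps of_nat_less_numeral_power_cancel_iff less_imp_le)
  then have Gt1: "norm (G t - G 1) \<le> 1/8" by simp
  have yt: "norm (y t) \<le> 1/9"
  proof -
    have "t ^ (2 ^ n) \<le> t ^ n" using t by (intro power_decreasing) (simp_all add: less_imp_le)
    then show ?thesis using n x t norm_iterated_square[OF tx, of n t] by (simp add: y_def)
  qed
  have "G t - e = y t * G t" using G[of t] t by (simp add: algebra_simps)
  then have "norm (G t - e) \<le> norm (y t) * norm (G t)" by (simp add: norm_mult_ineq)
  also have "\<dots> \<le> 1/9 * (1 + norm (G t - e))"
    using yt norm_triangle_sub[of "G t" e] norm_e by (intro mult_mono) simp_all
  finally have "norm (G t - e) \<le> 1/8" by simp
  then have G1: "norm (G 1 - e) \<le> 1/4"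
    using norm_triangle_ineq4[of "G t - e" "G t - G 1"] Gt1 by simp
  have y1: "norm (y 1) = 1" using norm_iterated_square[of x n] x by (simp add: y_def)
  have "y 1 = (e - y 1) * (G 1 - e)"
    using G[of 1] y_S[of 1] by (simp add: right_diff_distrib)
  then have "1 \<le> norm (e - y 1) * norm (G 1 - e)" using y1 norm_mult_ineq[of "e - y 1" "G 1 - e"] by simp
  also have "\<dots> \<le> 2 * (1/4)"
    using G1 y1 norm_e norm_triangle_ineq4[of e "y 1"] by (intro mult_mono) simp_all
  finally show False by simp
qed

text \<open>Together with \<open>spectrum_bound\<close> this makes the norm the largest modulus in
  the real spectrum, which is all that the functional calculus needs to know about the norm.\<close>

lemma norm_in_spectrum:
  assumes "x \<in> S" "x \<noteq> 0"
  shows "\<exists>t\<in>real_spectrum U e x. \<bar>t\<bar> = norm x"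
proof -
  let ?n = "norm x" and ?z = "(1 / norm x) *\<^sub>R x"
  have "\<not> (invertible_in U e (e - ?z) \<and> invertible_in U e (e + ?z))"
    using assms by (intro norm_one_not_invertible) simp_all
  moreover have "invertible_in U e (e - ?z) \<longleftrightarrow> invertible_in U e (x - ?n *\<^sub>R e)"
    using invertible_in_scaleR_iff[of "e - ?z" "- ?n"] assms by (simp add: scaleR_diff_right)
  moreover have "invertible_in U e (e + ?z) \<longleftrightarrow> invertible_in U e (x - (- ?n) *\<^sub>R e)"
    using invertible_in_scaleR_iff[of "e + ?z" "?n"] assms by (simp add: scaleR_add_right add.commute)
  ultimately show ?thesis
    unfolding real_spectrum_def by (metis abs_minus_cancel abs_norm_cancel mem_Collect_eq)
qed

end

section \<open>Continuous functional calculus\<close>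

lemma map_poly_of_real_pCons:
  "map_poly of_real (pCons a p) = pCons (of_real a) (map_poly of_real p :: complex poly)"
  by (rule poly_eqI) (simp add: coeff_map_poly coeff_pCons split: nat.split)

lemma map_poly_of_real_add:
  "map_poly of_real (p + q) = (map_poly of_real p + map_poly of_real q :: complex poly)"
  by (rule poly_eqI) (simp add: coeff_map_poly)

lemma map_poly_of_real_smult:
  "map_poly of_real (smult c p) = smult (of_real c) (map_poly of_real p :: complex poly)"
  by (rule poly_eqI) (simp add: coeff_map_poly)

lemma map_poly_of_real_mult:
  "map_poly of_real (p * q) = (map_poly of_real p * map_poly of_real q :: complex poly)"
  by (induction p)
    (simp_all add: map_poly_of_real_pCons map_poly_of_real_add map_poly_of_real_smult)

lemma poly_map_poly_of_real:
  "poly (map_poly of_real p) (of_real x) = (of_real (poly p x) :: complex)"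
  by (induction p) (simp_all add: map_poly_of_real_pCons)

text \<open>The remainder modulo the quadratic is real and at most linear; vanishing at a non-real
  point forces it to be 0.\<close>

lemma real_poly_quadratic_factor:
  fixes p :: "real poly"
  assumes root: "poly (map_poly of_real p) z = (0 :: complex)" and z: "Im z \<noteq> 0"
  shows "[:(Re z)\<^sup>2 + (Im z)\<^sup>2, - 2 * Re z, 1:] dvd p"
proof -
  let ?d = "[:(Re z)\<^sup>2 + (Im z)\<^sup>2, - 2 * Re z, 1:]" and ?C = "map_poly of_real :: real poly \<Rightarrow> complex poly"
  define r where "r = p mod ?d"
  have d0: "poly (?C ?d) z = 0"
    by (simp add: map_poly_of_real_pCons complex_eq_iff power2_eq_square algebra_simps)
  have "r = 0 \<or> degree r < 2"
    using degree_mod_less[of ?d p] by (auto simp: r_def)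
  then have r: "r = [:coeff r 0, coeff r 1:]"
    by (intro poly_eqI) (auto simp: coeff_pCons coeff_eq_0 split: nat.split)
  have "?C p = ?C (p div ?d * ?d + r)" by (simp only: r_def div_mult_mod_eq)
  also have "\<dots> = ?C (p div ?d) * ?C ?d + ?C r"
    by (simp only: map_poly_of_real_mult map_poly_of_real_add)
  finally have "poly (?C r) z = 0"
    using root d0 by simp
  then have "of_real (coeff r 0) + z * of_real (coeff r 1) = 0"
    by (subst (asm) r) (simp add: map_poly_of_real_pCons)
  then have "r = 0" using z by (subst r) (auto simp: complex_eq_iff)
  then show ?thesis by (simp add: r_def mod_eq_0_iff_dvd)
qed

lemma Weierstrass_real_poly:
  fixes f :: "real \<Rightarrow> real"
  assumes "compact K" "continuous_on K f"
  obtains p :: "nat \<Rightarrow> real poly" where "uniform_limit K (\<lambda>n. poly (p n)) f sequentially"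
proof -
  have "\<exists>p. \<forall>t\<in>K. \<bar>f t - poly p t\<bar> < inverse (real (Suc n))" for n
  proof -
    obtain g where g: "real_polynomial_function g" "\<And>t. t \<in> K \<Longrightarrow> \<bar>f t - g t\<bar> < inverse (real (Suc n))"
      using Stone_Weierstrass_real_polynomial_function[OF assms, of "inverse (real (Suc n))"] by auto
    then obtain a m where "g = (\<lambda>t. \<Sum>i\<le>m. a i * t ^ i)"
      by (auto simp: real_polynomial_function_iff_sum)
    then have "poly (\<Sum>i\<le>m. monom (a i) i) t = g t" for t
      by (simp add: poly_sum poly_monom)
    then show ?thesis using g by metis
  qed
  then obtain p where p: "\<And>n t. t \<in> K \<Longrightarrow> \<bar>f t - poly (p n) t\<bar> < inverse (real (Suc n))"
    by metis
  have "uniform_limit K (\<lambda>n. poly (p n)) f sequentially"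
    unfolding uniform_limit_sequentially_iff
  proof (intro allI impI)
    fix \<epsilon> :: real assume "\<epsilon> > 0"
    then obtain N where N: "inverse (real (Suc N)) < \<epsilon>" using reals_Archimedean by blast
    have "dist (poly (p n) t) (f t) < \<epsilon>" if "n \<ge> N" "t \<in> K" for n t
    proof -
      have "dist (poly (p n) t) (f t) < inverse (real (Suc n))"
        using p[OF that(2), of n] by (simp add: dist_real_def abs_minus_commute)
      also have "\<dots> \<le> inverse (real (Suc N))" using that by (intro le_imp_inverse_le) simp_all
      finally show ?thesis using N by simp
    qed
    then show "\<exists>N. \<forall>n\<ge>N. \<forall>t\<in>K. dist (poly (p n) t) (f t) < \<epsilon>" by blast
  qed
  then show ?thesis by (rule that)
qed

context sa_algebra
begin

section \<open>The spectrum and polynomials\<close>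

lemma spectrum_shift: "t \<in> real_spectrum U e x \<longleftrightarrow> t + s \<in> real_spectrum U e (x + s *\<^sub>R e)"
  by (simp add: real_spectrum_def scaleR_add_left)

lemma spectrum_uminus:
  assumes "x \<in> S"
  shows "t \<in> real_spectrum U e (- x) \<longleftrightarrow> - t \<in> real_spectrum U e x"
  using invertible_in_scaleR_iff[of "x + t *\<^sub>R e" "-1"] assms
  by (simp add: real_spectrum_def algebra_simps)

lemma spectrum_reflect:
  assumes "x \<in> S"
  shows "t \<in> real_spectrum U e (c *\<^sub>R e - x) \<longleftrightarrow> c - t \<in> real_spectrum U e x"
  using spectrum_shift[of "t - c" "- x" c] spectrum_uminus[OF assms, of "t - c"] by simp

lemma spectrum_bound:
  assumes "x \<in> S" "t \<in> real_spectrum U e x"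
  shows "\<bar>t\<bar> \<le> norm x"
proof (rule ccontr)
  assume "\<not> \<bar>t\<bar> \<le> norm x"
  then have t: "norm x < \<bar>t\<bar>" and "t \<noteq> 0" using norm_ge_zero[of x] by auto
  have "invertible_in U e (e - (1 / t) *\<^sub>R x)"
    using assms t \<open>t \<noteq> 0\<close> by (intro neumann_S) simp_all
  then have "invertible_in U e ((- t) *\<^sub>R (e - (1 / t) *\<^sub>R x))"
    using assms \<open>t \<noteq> 0\<close> by (intro invertible_in_scaleR) simp_all
  then show False using assms(2) \<open>t \<noteq> 0\<close> by (simp add: real_spectrum_def algebra_simps)
qed

text \<open>If \<open>y\<close> inverts \<open>x - t e\<close>, then
  \<open>x - s e = (x - t e) * (e - (s - t) y)\<close>, and the Neumann series inverts the second
  factor for \<open>s\<close> close to \<open>t\<close>.\<close>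

lemma compact_spectrum:
  assumes x: "x \<in> S"
  shows "compact (real_spectrum U e x)"
proof -
  have "open (- real_spectrum U e x)"
    unfolding open_dist
  proof
    fix t assume "t \<in> - real_spectrum U e x"
    then have "invertible_in U e (x - t *\<^sub>R e)" by (simp add: real_spectrum_def)
    then obtain y where y: "y \<in> S" "(x - t *\<^sub>R e) * y = e" "y * (x - t *\<^sub>R e) = e"
      using invertible_inE x by (metis S_closed(3,4) e_S)
    have "s \<in> - real_spectrum U e x" if "dist s t < inverse (norm y + 1)" for s
    proof -
      have ny: "0 < norm y + 1" using norm_ge_zero[of y] by linarith
      have "\<bar>s - t\<bar> * norm y \<le> \<bar>s - t\<bar> * (norm y + 1)" by (intro mult_left_mono) simp_all
      also have "\<dots> < 1" using that ny by (simp add: dist_real_def field_simps)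
      finally have "invertible_in U e (e - (s - t) *\<^sub>R y)"
        using y by (intro neumann_S) simp_all
      moreover have "(x - t *\<^sub>R e) * (e - (s - t) *\<^sub>R y) = x - s *\<^sub>R e"
        using x y by (simp add: right_diff_distrib scaleR_diff_left)
      moreover have "(e - (s - t) *\<^sub>R y) * (x - t *\<^sub>R e) = x - s *\<^sub>R e"
        using x y(1) by (simp add: left_diff_distrib y(3) scaleR_diff_left)
      ultimately have "invertible_in U e (x - s *\<^sub>R e)"
        using invertible_in_mult[of "x - t *\<^sub>R e" "e - (s - t) *\<^sub>R y"] x y
          invertible_inI[of y "x - t *\<^sub>R e"] by simp
      then show ?thesis by (simp add: real_spectrum_def)
    qed
    moreover have "inverse (norm y + 1) > 0"
      using norm_ge_zero[of y] by (simp add: add_nonneg_pos)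
    ultimately show "\<exists>d>0. \<forall>s. dist s t < d \<longrightarrow> s \<in> - real_spectrum U e x" by blast
  qed
  moreover have "bounded (real_spectrum U e x)"
    using spectrum_bound[OF x] by (intro boundedI[of _ "norm x"]) simp
  ultimately show ?thesis by (simp add: compact_eq_bounded_closed closed_def)
qed

lemma spectrum_nonempty:
  assumes "x \<in> S" "e \<noteq> 0"
  shows "real_spectrum U e x \<noteq> {}"
proof (cases "x = 0")
  case True
  then have "0 \<in> real_spectrum U e x" using assms by (simp add: real_spectrum_def invertible_in_def)
  then show ?thesis by blast
next
  case False
  then show ?thesis using norm_in_spectrum assms by blast
qed

lemma poly_at_linear: "x \<in> S \<Longrightarrow> poly_at e [:- t, 1:] x = x - t *\<^sub>R e"
  by (simp add: poly_at_pCons)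

text \<open>A factor is split off at a complex root. A real root lies outside the spectrum and gives
  an invertible linear factor; a non-real root gives a quadratic factor, which is always invertible.
  The roots of the quotient are roots of \<open>p\<close>, so the induction applies to it.\<close>

lemma invertible_in_poly_at:
  assumes x: "x \<in> S" and "p \<noteq> 0" "\<And>t. t \<in> real_spectrum U e x \<Longrightarrow> poly p t \<noteq> 0"
  shows "invertible_in U e (poly_at e p x)"
  using assms(2-)
proof (induction "degree p" arbitrary: p rule: less_induct)
  case less
  let ?C = "map_poly of_real p :: complex poly"
  have step: "invertible_in U e (poly_at e p x)"
    if p: "p = d * q" and d: "invertible_in U e (poly_at e d x)" "degree d > 0" for d q
  proof -
    have "q \<noteq> 0" "d \<noteq> 0" using p less.prems by auto
    then have "degree q < degree p" using d by (simp add: p degree_mult_eq)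
    then have "invertible_in U e (poly_at e q x)"
      using less.prems \<open>q \<noteq> 0\<close> p by (intro less.hyps) auto
    then show ?thesis
      using x d unfolding p poly_at_mult_S[OF x]
      by (intro invertible_in_mult poly_at_commute poly_at_S)
  qed
  show ?case
  proof (cases "degree p = 0")
    case True
    then obtain c where "p = [:c:]" by (elim degree_eq_zeroE)
    then show ?thesis using less.prems(1)
      by (intro invertible_inI[of "inverse c *\<^sub>R e"]) (simp_all add: poly_at_pCons)
  next
    case False
    then have "degree ?C \<noteq> 0" by (simp add: degree_map_poly)
    then obtain z where z: "poly ?C z = 0"
      using fundamental_theorem_of_algebra constant_degree by metis
    show ?thesis
    proof (cases "Im z = 0")
      case True
      then have "z = of_real (Re z)" by (simp add: complex_eq_iff)
      then have "poly p (Re z) = 0" using z by (metis of_real_0 of_real_eq_iff poly_map_poly_of_real)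
      then have "Re z \<notin> real_spectrum U e x" "[:- Re z, 1:] dvd p"
        using less.prems by (auto simp: poly_eq_0_iff_dvd)
      then show ?thesis
        using step[of "[:- Re z, 1:]"] x by (auto simp: poly_at_linear real_spectrum_def elim: dvdE)
    next
      case False
      let ?d = "[:(Re z)\<^sup>2 + (Im z)\<^sup>2, - 2 * Re z, 1:]"
      have two: "(2 * Re z) *\<^sub>R x = Re z *\<^sub>R x + Re z *\<^sub>R x" by (simp add: scaleR_add_left[symmetric])
      have "poly_at e ?d x = (x - Re z *\<^sub>R e) * (x - Re z *\<^sub>R e) + (Im z)\<^sup>2 *\<^sub>R e"
        using x two by (simp add: poly_at_pCons algebra_simps power2_eq_square)
      then have "invertible_in U e (poly_at e ?d x)"
        using invertible_in_quadratic[OF x False, of "Re z"] by simp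
      moreover obtain q where "p = ?d * q"
        using real_poly_quadratic_factor[OF z False] by (elim dvdE)
      ultimately show ?thesis using step[of ?d q] by simp
    qed
  qed
qed

text \<open>This half of the spectral mapping theorem suffices for norm estimates. It is
  invertibility of \<open>p - s\<close> at \<open>x\<close>.\<close>

lemma spectrum_poly_at:
  assumes x: "x \<in> S" and s: "s \<in> real_spectrum U e (poly_at e p x)"
  shows "\<exists>t\<in>real_spectrum U e x. poly p t = s"
proof (rule ccontr)
  assume none: "\<not> ?thesis"
  have eq: "poly_at e (p - [:s:]) x = poly_at e p x - s *\<^sub>R e"
    by (simp add: poly_at_diff poly_at_pCons)
  have not_inv: "\<not> invertible_in U e (poly_at e p x - s *\<^sub>R e)"
    using s by (simp add: real_spectrum_def)
  show False
  proof (cases "p - [:s:] = 0")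
    \<comment> \<open>A constant polynomial takes the value \<open>s\<close> only if there is a
      point in the spectrum, so the zero algebra has to be ruled out here.\<close>
    case True
    have "e \<noteq> 0"
    proof
      assume "e = 0"
      then have "invertible_in U e 0" by (intro invertible_inI[of 0]) simp_all
      then show False using not_inv eq[unfolded True] by simp
    qed
    then show ?thesis using spectrum_nonempty[OF x] none True by auto
  next
    case False
    then show ?thesis
      using invertible_in_poly_at[OF x False] none not_inv by (auto simp: eq)
  qed
qed

text \<open>Contractivity for the supremum norm on the spectrum is what extends the calculus from
  polynomials to continuous functions.\<close>

lemma norm_poly_at_le:
  assumes x: "x \<in> S" and le: "\<And>t. t \<in> real_spectrum U e x \<Longrightarrow> \<bar>poly p t\<bar> \<le> M" and "0 \<le> M"
  shows "norm (poly_at e p x) \<le> M"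
proof (cases "poly_at e p x = 0")
  case False
  then show ?thesis
    using norm_in_spectrum[OF poly_at_S[OF x] False] spectrum_poly_at[OF x] le by metis
qed (use assms in simp)

text \<open>\<open>cfc\<close> is a description that ranges over all approximating sequences, so a
  limit has to exist and to be the same for every sequence.\<close>

lemma cfc_limit:
  assumes x: "x \<in> S" and f: "continuous_on (real_spectrum U e x) f"
    and p: "uniform_limit (real_spectrum U e x) (\<lambda>n. poly (p n)) f sequentially"
  shows "(\<lambda>n. poly_at e (p n) x) \<longlonglongrightarrow> cfc U e f x"
proof -
  let ?K = "real_spectrum U e x"
  \<comment> \<open>The indices of the two sequences are independent: equal sequences give the
    Cauchy property, different ones the common limit.\<close>
  have bound: "\<exists>N. \<forall>n\<ge>N. \<forall>m\<ge>N. norm (poly_at e (q n) x - poly_at e (r m) x) < \<epsilon>"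
    if q: "uniform_limit ?K (\<lambda>n. poly (q n)) f sequentially"
      and r: "uniform_limit ?K (\<lambda>n. poly (r n)) f sequentially" and "\<epsilon> > 0" for q r and \<epsilon> :: real
  proof -
    obtain N where N: "\<And>n t. n \<ge> N \<Longrightarrow> t \<in> ?K \<Longrightarrow> dist (poly (q n) t) (f t) < \<epsilon> / 2 / 2"
      using q \<open>\<epsilon> > 0\<close> unfolding uniform_limit_sequentially_iff by (metis half_gt_zero)
    obtain M where M: "\<And>n t. n \<ge> M \<Longrightarrow> t \<in> ?K \<Longrightarrow> dist (poly (r n) t) (f t) < \<epsilon> / 2 / 2"
      using r \<open>\<epsilon> > 0\<close> unfolding uniform_limit_sequentially_iff by (metis half_gt_zero)
    have "norm (poly_at e (q n) x - poly_at e (r m) x) < \<epsilon>" if "n \<ge> max N M" "m \<ge> max N M" for n m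
    proof -
      have "norm (poly_at e (q n - r m) x) \<le> \<epsilon> / 2"
      proof (rule norm_poly_at_le[OF x])
        fix t assume t: "t \<in> ?K"
        have "dist (poly (q n) t) (poly (r m) t) < \<epsilon> / 2"
          by (rule dist_triangle_half_l[OF N M]) (use t that in simp_all)
        then show "\<bar>poly (q n - r m) t\<bar> \<le> \<epsilon> / 2" by (simp add: dist_real_def)
      qed (use \<open>\<epsilon> > 0\<close> in simp)
      then show ?thesis using \<open>\<epsilon> > 0\<close> by (simp add: poly_at_diff)
    qed
    then show ?thesis by blast
  qed
  obtain q where q: "uniform_limit ?K (\<lambda>n. poly (q n)) f sequentially"
    using Weierstrass_real_poly[OF compact_spectrum[OF x] f] .
  have "Cauchy (\<lambda>n. poly_at e (q n) x)"
    by (rule CauchyI) (rule bound[OF q q])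
  then obtain b where b: "(\<lambda>n. poly_at e (q n) x) \<longlonglongrightarrow> b"
    by (auto simp: Cauchy_convergent_iff convergent_def)
  have lim: "(\<lambda>n. poly_at e (r n) x) \<longlonglongrightarrow> b"
    if r: "uniform_limit ?K (\<lambda>n. poly (r n)) f sequentially" for r
  proof -
    have "(\<lambda>n. poly_at e (r n) x - poly_at e (q n) x) \<longlonglongrightarrow> 0"
    proof (rule LIMSEQ_I)
      fix \<epsilon> :: real assume "\<epsilon> > 0"
      then obtain N where "\<forall>n\<ge>N. \<forall>m\<ge>N. norm (poly_at e (r n) x - poly_at e (q m) x) < \<epsilon>"
        using bound[OF r q] by metis
      then show "\<exists>N. \<forall>n\<ge>N. norm (poly_at e (r n) x - poly_at e (q n) x - 0) < \<epsilon>"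
        by (intro exI[of _ N]) simp
    qed
    then show ?thesis using tendsto_add[OF _ b] by fastforce
  qed
  have "cfc U e f x = b"
    unfolding cfc_def
  proof (rule the_equality)
    fix b' assume "\<forall>p. uniform_limit ?K (\<lambda>n. poly (p n)) f sequentially \<longrightarrow> (\<lambda>n. poly_at e (p n) x) \<longlonglongrightarrow> b'"
    then show "b' = b" using q b LIMSEQ_unique by blast
  qed (use lim in blast)
  then show ?thesis using lim[OF p] by simp
qed

section \<open>Rules of the functional calculus\<close>

lemma cfc_approx:
  assumes x: "x \<in> S" and f: "continuous_on (real_spectrum U e x) f"
  obtains p where "uniform_limit (real_spectrum U e x) (\<lambda>n. poly (p n)) f sequentially"
    "(\<lambda>n. poly_at e (p n) x) \<longlonglongrightarrow> cfc U e f x"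
  using Weierstrass_real_poly[OF compact_spectrum[OF x] f] cfc_limit[OF x f] by metis

lemma cfc_S:
  assumes x: "x \<in> S" and f: "continuous_on (real_spectrum U e x) f"
  shows "cfc U e f x \<in> S"
  by (rule cfc_approx[OF assms], rule closed_sequentially[OF closed_S]) (auto simp: poly_at_S x)

lemma cfc_cong:
  assumes "\<And>t. t \<in> real_spectrum U e x \<Longrightarrow> f t = g t"
  shows "cfc U e f x = cfc U e g x"
proof -
  have "uniform_limit (real_spectrum U e x) (\<lambda>n. poly (p n)) f sequentially \<longleftrightarrow>
    uniform_limit (real_spectrum U e x) (\<lambda>n. poly (p n)) g sequentially" for p :: "nat \<Rightarrow> real poly"
    using assms by (intro uniform_limit_cong') simp_all
  then show ?thesis by (simp add: cfc_def)
qed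

lemma cfc_poly:
  assumes "x \<in> S"
  shows "cfc U e (poly p) x = poly_at e p x"
proof -
  have "(\<lambda>n. poly_at e p x) \<longlonglongrightarrow> cfc U e (poly p) x"
    by (rule cfc_limit[OF assms]) (auto intro: continuous_intros uniform_limit_const)
  then show ?thesis by (simp add: LIMSEQ_const_iff)
qed

lemma cfc_const: "x \<in> S \<Longrightarrow> cfc U e (\<lambda>t. c) x = c *\<^sub>R e"
  using cfc_poly[of x "[:c:]"] cfc_cong[of x "poly [:c:]" "\<lambda>t. c"] by (simp add: poly_at_pCons)

lemma cfc_id: "x \<in> S \<Longrightarrow> cfc U e (\<lambda>t. t) x = x"
  using cfc_poly[of x "[:0, 1:]"] cfc_cong[of x "poly [:0, 1:]" "\<lambda>t. t"] by (simp add: poly_at_pCons)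

lemma cfc_add:
  assumes x: "x \<in> S" and f: "continuous_on (real_spectrum U e x) f"
    and g: "continuous_on (real_spectrum U e x) g"
  shows "cfc U e (\<lambda>t. f t + g t) x = cfc U e f x + cfc U e g x"
proof -
  obtain p where p: "uniform_limit (real_spectrum U e x) (\<lambda>n. poly (p n)) f sequentially"
    "(\<lambda>n. poly_at e (p n) x) \<longlonglongrightarrow> cfc U e f x" using cfc_approx[OF x f] .
  obtain q where q: "uniform_limit (real_spectrum U e x) (\<lambda>n. poly (q n)) g sequentially"
    "(\<lambda>n. poly_at e (q n) x) \<longlonglongrightarrow> cfc U e g x" using cfc_approx[OF x g] .
  have "(\<lambda>n. poly_at e (p n + q n) x) \<longlonglongrightarrow> cfc U e (\<lambda>t. f t + g t) x"
    by (rule cfc_limit[OF x]) (use f g uniform_limit_add[OF p(1) q(1)] in \<open>simp_all add: poly_add[abs_def] continuous_on_add\<close>)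
  then show ?thesis
    using tendsto_add[OF p(2) q(2)] by (simp add: poly_at_add LIMSEQ_unique)
qed

lemma cfc_mult:
  assumes x: "x \<in> S" and f: "continuous_on (real_spectrum U e x) f"
    and g: "continuous_on (real_spectrum U e x) g"
  shows "cfc U e (\<lambda>t. f t * g t) x = cfc U e f x * cfc U e g x"
proof -
  have bdd: "bounded (f ` real_spectrum U e x)" "bounded (g ` real_spectrum U e x)"
    using compact_continuous_image compact_imp_bounded compact_spectrum[OF x] f g by blast+
  obtain p where p: "uniform_limit (real_spectrum U e x) (\<lambda>n. poly (p n)) f sequentially"
    "(\<lambda>n. poly_at e (p n) x) \<longlonglongrightarrow> cfc U e f x" using cfc_approx[OF x f] .
  obtain q where q: "uniform_limit (real_spectrum U e x) (\<lambda>n. poly (q n)) g sequentially"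
    "(\<lambda>n. poly_at e (q n) x) \<longlonglongrightarrow> cfc U e g x" using cfc_approx[OF x g] .
  have "(\<lambda>n. poly_at e (p n * q n) x) \<longlonglongrightarrow> cfc U e (\<lambda>t. f t * g t) x"
    by (rule cfc_limit[OF x]) (use f g uniform_lim_mult[OF p(1) q(1) bdd] in \<open>simp_all add: poly_mult[abs_def] continuous_on_mult\<close>)
  then show ?thesis
    using tendsto_mult[OF p(2) q(2)] x by (simp add: poly_at_mult_S LIMSEQ_unique)
qed

lemma cfc_scaleR:
  assumes x: "x \<in> S" and f: "continuous_on (real_spectrum U e x) f"
  shows "cfc U e (\<lambda>t. c * f t) x = c *\<^sub>R cfc U e f x"
  using cfc_mult[OF x _ f, of "\<lambda>t. c"] cfc_S[OF x f] x by (simp add: cfc_const)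

lemma cfc_diff:
  assumes x: "x \<in> S" and f: "continuous_on (real_spectrum U e x) f"
    and g: "continuous_on (real_spectrum U e x) g"
  shows "cfc U e (\<lambda>t. f t - g t) x = cfc U e f x - cfc U e g x"
  using cfc_add[OF x f continuous_on_minus[OF g]] cfc_scaleR[OF x g, of "-1"] by simp

lemma cfc_inverse:
  assumes x: "x \<in> S" and f: "continuous_on (real_spectrum U e x) f"
    and nz: "\<And>t. t \<in> real_spectrum U e x \<Longrightarrow> f t \<noteq> 0"
  shows "cfc U e f x * cfc U e (\<lambda>t. inverse (f t)) x = e"
    "cfc U e (\<lambda>t. inverse (f t)) x * cfc U e f x = e"
    "cfc U e (\<lambda>t. inverse (f t)) x \<in> S"
proof -
  have g: "continuous_on (real_spectrum U e x) (\<lambda>t. inverse (f t))"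
    using f nz by (intro continuous_intros) auto
  show "cfc U e f x * cfc U e (\<lambda>t. inverse (f t)) x = e"
    using cfc_cong[of x "\<lambda>t. f t * inverse (f t)" "\<lambda>t. 1"] nz x
    by (simp add: cfc_mult[OF x f g, symmetric] cfc_const)
  show "cfc U e (\<lambda>t. inverse (f t)) x * cfc U e f x = e"
    using cfc_cong[of x "\<lambda>t. inverse (f t) * f t" "\<lambda>t. 1"] nz x
    by (simp add: cfc_mult[OF x g f, symmetric] cfc_const)
  show "cfc U e (\<lambda>t. inverse (f t)) x \<in> S" by (rule cfc_S[OF x g])
qed

section \<open>Inverses and positive elements\<close>

lemma invm_eqI:
  assumes "x \<in> S" "y \<in> S" "x * y = e" "y * x = e"
  shows "invm U e x = y"
proof -
  have "0 \<notin> real_spectrum U e x"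
    using invertible_inI assms by (auto simp: real_spectrum_def)
  then have "x * invm U e x = e" "invm U e x \<in> S"
    using cfc_inverse[of x "\<lambda>t. t"] assms(1) by (auto simp: invm_def cfc_id)
  then show ?thesis using inverse_unique assms by metis
qed

lemma invm_cfc:
  assumes x: "x \<in> S" and f: "continuous_on (real_spectrum U e x) f"
    and nz: "\<And>t. t \<in> real_spectrum U e x \<Longrightarrow> f t \<noteq> 0"
  shows "invm U e (cfc U e f x) = cfc U e (\<lambda>t. inverse (f t)) x"
  using cfc_inverse[OF assms] cfc_S[OF x f] by (intro invm_eqI)

text \<open>For negative \<open>t\<close>, \<open>k * k - t e\<close> is an invertible quadratic in
  \<open>k\<close> with centre 0 and \<open>r = sqrt (- t)\<close>.\<close>

lemma spectrum_square:
  assumes "k \<in> S"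
  shows "real_spectrum U e (k * k) \<subseteq> {0..}"
proof
  fix t assume t: "t \<in> real_spectrum U e (k * k)"
  show "t \<in> {0..}"
  proof (rule ccontr)
    assume "t \<notin> {0..}"
    then show False
      using invertible_in_quadratic[OF assms, of "sqrt (- t)" 0] t by (simp add: real_spectrum_def)
  qed
qed

lemma cfc_nonneg_square:
  assumes x: "x \<in> S" and f: "continuous_on (real_spectrum U e x) f"
    and nn: "\<And>t. t \<in> real_spectrum U e x \<Longrightarrow> f t \<ge> 0"
  obtains k where "k \<in> S" "cfc U e f x = k * k"
proof
  have g: "continuous_on (real_spectrum U e x) (\<lambda>t. sqrt (f t))"
    by (intro continuous_intros f)
  show "cfc U e (\<lambda>t. sqrt (f t)) x \<in> S" by (rule cfc_S[OF x g])
  show "cfc U e f x = cfc U e (\<lambda>t. sqrt (f t)) x * cfc U e (\<lambda>t. sqrt (f t)) x"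
    unfolding cfc_mult[OF x g g, symmetric] by (rule cfc_cong) (simp add: nn)
qed

lemma cfc_nonneg:
  assumes "x \<in> S" "continuous_on (real_spectrum U e x) f"
    and "\<And>t. t \<in> real_spectrum U e x \<Longrightarrow> f t \<ge> 0"
  shows "real_spectrum U e (cfc U e f x) \<subseteq> {0..}"
  using cfc_nonneg_square[OF assms] spectrum_square by metis

text \<open>The spectrum lies in \<open>[-c, c]\<close>, so reflecting it to \<open>c - t\<close>
  keeps it within \<open>[-c, c]\<close> exactly when no \<open>t\<close> is negative. Positivity
  becomes a closed condition on \<open>x\<close>, and one that quadratic forms can verify for
  operators.\<close>

lemma spectrum_nonneg_iff:
  assumes x: "x \<in> S" and c: "norm x \<le> c"
  shows "real_spectrum U e x \<subseteq> {0..} \<longleftrightarrow> norm (c *\<^sub>R e - x) \<le> c"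
proof
  assume nn: "real_spectrum U e x \<subseteq> {0..}"
  show "norm (c *\<^sub>R e - x) \<le> c"
  proof (cases "c *\<^sub>R e - x = 0")
    case True
    then show ?thesis using c norm_ge_zero[of x] by (simp add: order_trans[OF norm_ge_zero])
  next
    case False
    then obtain t where t: "t \<in> real_spectrum U e (c *\<^sub>R e - x)" "\<bar>t\<bar> = norm (c *\<^sub>R e - x)"
      using norm_in_spectrum[of "c *\<^sub>R e - x"] x by auto
    then have "c - t \<in> real_spectrum U e x" by (simp add: spectrum_reflect[OF x])
    then have "0 \<le> c - t" "\<bar>c - t\<bar> \<le> c" using nn spectrum_bound[OF x] c by force+
    then show ?thesis using t by linarith
  qed
next
  assume le: "norm (c *\<^sub>R e - x) \<le> c"
  show "real_spectrum U e x \<subseteq> {0..}"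
  proof
    fix t assume "t \<in> real_spectrum U e x"
    then have "c - t \<in> real_spectrum U e (c *\<^sub>R e - x)" by (simp add: spectrum_reflect[OF x])
    then have "\<bar>c - t\<bar> \<le> c" using spectrum_bound[of "c *\<^sub>R e - x"] x le by force
    then show "t \<in> {0..}" by simp
  qed
qed

end

section \<open>The entropy inequalities in the abstract setting\<close>

lemma ln_ge_two_times_diff_div:
  fixes s :: real
  assumes "1 \<le> s"
  shows "2 * (s - 1) / (s + 1) \<le> ln s"
proof -
  let ?f = "\<lambda>s::real. ln s - 2 * (s - 1) / (s + 1)"
  have "?f 1 \<le> ?f s"
  proof (rule DERIV_nonneg_imp_nondecreasing[OF assms])
    fix x :: real assume x: "1 \<le> x" "x \<le> s"
    have "(?f has_real_derivative 1 / x - (2 * (x + 1) - 2 * (x - 1)) / (x + 1)\<^sup>2) (at x)"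
      using x by (auto intro!: derivative_eq_intros simp: power2_eq_square)
    also have "1 / x - (2 * (x + 1) - 2 * (x - 1)) / (x + 1)\<^sup>2 = (x - 1)\<^sup>2 / (x * (x + 1)\<^sup>2)"
      using x by (simp add: divide_simps) (simp add: algebra_simps power2_eq_square)
    finally have "(?f has_real_derivative (x - 1)\<^sup>2 / (x * (x + 1)\<^sup>2)) (at x)" .
    then show "\<exists>y. (?f has_real_derivative y) (at x) \<and> 0 \<le> y" using x by force
  qed
  then show ?thesis by simp
qed

lemma two_times_ln_le_diff_inverse:
  fixes s :: real
  assumes "1 \<le> s"
  shows "2 * ln s \<le> s - 1 / s"
proof -
  let ?f = "\<lambda>s::real. s - 1 / s - 2 * ln s"
  have "?f 1 \<le> ?f s"
  proof (rule DERIV_nonneg_imp_nondecreasing[OF assms])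
    fix x :: real assume x: "1 \<le> x" "x \<le> s"
    have "(?f has_real_derivative 1 + 1 / x\<^sup>2 - 2 / x) (at x)"
      using x by (auto intro!: derivative_eq_intros simp: power2_eq_square)
    also have "1 + 1 / x\<^sup>2 - 2 / x = (1 - 1 / x)\<^sup>2"
      using x by (simp add: power2_diff power_divide)
    finally have "(?f has_real_derivative (1 - 1 / x)\<^sup>2) (at x)" .
    then show "\<exists>y. (?f has_real_derivative y) (at x) \<and> 0 \<le> y" by force
  qed
  then show ?thesis by simp
qed

text \<open>With \<open>t = s * s\<close> and the factor \<open>t powr \<alpha>\<close> removed, the
  chain reads \<open>2 - 4 / (1 + s^2) \<le> 4 - 8 / (s + 1) \<le> 2 ln s \<le> s - 1 / s \<le> (s^2
  - 1 / s^2) / 2\<close>. The inner two steps are the preceding lemmas at \<open>s\<close>; in the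
  outer two the difference has the factor \<open>(s - 1)^3\<close>.\<close>

lemma log_bounds_chain:
  fixes t \<alpha> :: real
  assumes "1 \<le> t"
  shows "2 * ((1 - 2 * inverse (1 + t)) * t powr \<alpha>)
      \<le> 4 * t powr \<alpha> - 8 * (t powr \<alpha> * inverse (t powr (1/2) + 1))" (is "?I \<le> ?II")
    and "4 * t powr \<alpha> - 8 * (t powr \<alpha> * inverse (t powr (1/2) + 1)) \<le> t powr \<alpha> * ln t"
    and "t powr \<alpha> * ln t \<le> t powr (\<alpha> + 1/2) - t powr (\<alpha> - 1/2)"
    and "t powr (\<alpha> + 1/2) - t powr (\<alpha> - 1/2) \<le> (1/2) * (t powr (\<alpha> + 1) - t powr (\<alpha> - 1))"
proof -
  define s where "s = sqrt t"
  have s: "1 \<le> s" using assms by (simp add: s_def)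
  have t: "t = s * s" using assms by (simp add: s_def)
  have half: "t powr (1/2) = s" using assms by (simp add: s_def powr_half_sqrt)
  define w where "w = t powr \<alpha>"
  have w: "w > 0" using assms by (simp add: w_def)
  have pw: "t powr (\<alpha> + 1/2) = w * s" "t powr (\<alpha> - 1/2) = w * (1 / s)"
    "t powr (\<alpha> + 1) = w * (s * s)" "t powr (\<alpha> - 1) = w * (1 / (s * s))"
    using assms s by (simp_all add: w_def powr_add powr_diff half flip: t)
  have ln: "ln t = 2 * ln s" using s by (simp add: t ln_mult)
  have "2 * (1 - 2 / (1 + s * s)) \<le> 4 - 8 / (s + 1)"
  proof -
    have "4 - 8 / (s + 1) - 2 * (1 - 2 / (1 + s * s)) = 2 * (s - 1) ^ 3 / ((s + 1) * (1 + s * s))"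
      using s by (simp add: divide_simps add_nonneg_eq_0_iff) (simp add: algebra_simps power3_eq_cube)
    also have "\<dots> \<ge> 0" using s by simp
    finally show ?thesis by simp
  qed
  from mult_left_mono[OF this less_imp_le[OF w]]
  show "?I \<le> ?II" unfolding half w_def[symmetric] t[symmetric] by (simp add: field_simps flip: t)
  have "4 - 8 / (s + 1) \<le> ln t"
    using ln_ge_two_times_diff_div[OF s] s by (simp add: ln field_simps)
  from mult_left_mono[OF this less_imp_le[OF w]]
  show "4 * t powr \<alpha> - 8 * (t powr \<alpha> * inverse (t powr (1/2) + 1)) \<le> t powr \<alpha> * ln t"
    unfolding half w_def[symmetric] by (simp add: field_simps)
  have "ln t \<le> s - 1 / s" using two_times_ln_le_diff_inverse[OF s] by (simp add: ln)
  from mult_left_mono[OF this less_imp_le[OF w]]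
  show "t powr \<alpha> * ln t \<le> t powr (\<alpha> + 1/2) - t powr (\<alpha> - 1/2)"
    unfolding pw w_def[symmetric] by (simp add: right_diff_distrib)
  have "s - 1 / s \<le> (1/2) * (s * s - 1 / (s * s))"
  proof -
    have "(1/2) * (s * s - 1 / (s * s)) - (s - 1 / s) = (s - 1) ^ 3 * (s + 1) / (2 * s * s)"
      using s by (simp add: divide_simps) (simp add: algebra_simps power3_eq_cube)
    also have "\<dots> \<ge> 0" using s by simp
    finally show ?thesis by simp
  qed
  from mult_left_mono[OF this less_imp_le[OF w]]
  show "t powr (\<alpha> + 1/2) - t powr (\<alpha> - 1/2) \<le> (1/2) * (t powr (\<alpha> + 1) - t powr (\<alpha> - 1))"
    unfolding pw by (simp add: right_diff_distrib)
qed

section \<open>Positivity of sandwiches\<close>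

context sa_algebra
begin

text \<open>The inverse is again a sandwich, so it belongs to \<open>S\<close> although the factors
  need not commute.\<close>

lemma sandwich_inverse:
  assumes d: "d \<in> S" "d' \<in> S" "d * d' = e" "d' * d = e"
    and p: "p \<in> S" "p' \<in> S" "p * p' = e" "p' * p = e"
  shows "invertible_in U e (d * p * d)"
proof (rule invertible_inI)
  show "d' * p' * d' \<in> S" using sandwich_S d p by simp
  have cancel: "d * (d' * z) = e * z" "d' * (d * z) = e * z" "p * (p' * z) = e * z" "p' * (p * z) = e * z" for z
    by (simp_all add: d p flip: mult.assoc)
  show "d * p * d * (d' * p' * d') = e" "d' * p' * d' * (d * p * d) = e"
    using d p by (simp_all add: mult.assoc cancel)
qed

text \<open>Along the segment from \<open>e\<close> to \<open>d\<close> the element \<open>d\<^sub>s p d\<^sub>s\<close> stays invertible, so its spectrum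
  cannot leave the positive half-line.\<close>

lemma sandwich_nonneg_invertible:
  assumes a: "a \<in> S" and g: "continuous_on (real_spectrum U e a) g"
    and g_pos: "\<And>t. t \<in> real_spectrum U e a \<Longrightarrow> g t > 0"
    and p: "p \<in> S" "real_spectrum U e p \<subseteq> {0..}" "invertible_in U e p"
  defines "d \<equiv> cfc U e g a"
  shows "real_spectrum U e (d * p * d) \<subseteq> {0..}"
proof -
  have d: "d \<in> S" using cfc_S[OF a g] by (simp add: d_def)
  \<comment> \<open>\<open>D s\<close> is the value at \<open>a\<close> of
    \<open>(1 - s) + s * g\<close>, which is positive on the spectrum; so it is invertible for every
    \<open>s\<close> in \<open>[0, 1]\<close>.\<close>
  define D where "D s = (1 - s) *\<^sub>R e + s *\<^sub>R d" for s
  define h where "h s = D s * p * D s" for s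
  define M where "M = 1 + norm d"
  define c where "c = M * norm p * M + 1"
  have M: "M \<ge> 0" by (simp add: M_def)
  then have c: "c > 0" by (simp add: c_def add_nonneg_pos)
  have D_S: "D s \<in> S" for s using d by (simp add: D_def)
  then have h_S: "h s \<in> S" for s using sandwich_S p by (simp add: h_def)
  have D_cfc: "D s = cfc U e (\<lambda>t. (1 - s) + s * g t) a" for s
    using a g cfc_add[of a "\<lambda>t. 1 - s" "\<lambda>t. s * g t"]
    by (simp add: D_def d_def cfc_const cfc_scaleR continuous_on_mult_left)
  have inv: "invertible_in U e (h s)" if "0 \<le> s" "s \<le> 1" for s
  proof -
    have "continuous_on (real_spectrum U e a) (\<lambda>t. (1 - s) + s * g t)"
      by (intro continuous_intros g)
    moreover have "(1 - s) + s * g t \<noteq> 0" if "t \<in> real_spectrum U e a" for t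
      using g_pos[OF that] \<open>0 \<le> s\<close> \<open>s \<le> 1\<close>
      by (cases "s = 0") (auto simp: add_nonneg_pos[THEN less_imp_neq, THEN not_sym])
    ultimately obtain d' where "d' \<in> S" "D s * d' = e" "d' * D s = e"
      using cfc_inverse[OF a] unfolding D_cfc by metis
    moreover obtain p' where "p' \<in> S" "p * p' = e" "p' * p = e" using invertible_inE p by metis
    ultimately show ?thesis using D_S p sandwich_inverse unfolding h_def by metis
  qed
  have bound: "norm (h s) < c" if "0 \<le> s" "s \<le> 1" for s
  proof -
    have "norm (D s) \<le> (1 - s) * norm e + s * norm d"
      using that norm_triangle_ineq[of "(1 - s) *\<^sub>R e" "s *\<^sub>R d"] by (simp add: D_def)
    also have "\<dots> \<le> 1 * 1 + 1 * norm d"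
      using that norm_e by (intro add_mono mult_mono) simp_all
    finally have D: "norm (D s) \<le> M" by (simp add: M_def)
    have "norm (h s) \<le> norm (D s) * norm p * norm (D s)"
      unfolding h_def by (rule order_trans[OF norm_mult_ineq mult_right_mono[OF norm_mult_ineq norm_ge_zero]])
    also have "\<dots> \<le> M * norm p * M" using D M by (intro mult_mono) simp_all
    finally show ?thesis by (simp add: c_def)
  qed
  \<comment> \<open>Positivity of \<open>h s\<close> is \<open>\<phi> s \<le> c\<close>. It holds at
    0, and \<open>\<phi> s = c\<close> would put 0 or \<open>2 c\<close> into the spectrum of
    \<open>h s\<close>: the former contradicts invertibility, the latter the strict norm
    bound.\<close>
  define \<phi> where "\<phi> s = norm (c *\<^sub>R e - h s)" for s
  have "continuous_on {0..1} \<phi>"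
    unfolding \<phi>_def h_def D_def by (intro continuous_intros)
  moreover have "\<phi> s \<noteq> c" if "0 \<le> s" "s \<le> 1" for s
  proof
    assume eq: "\<phi> s = c"
    then have "c *\<^sub>R e - h s \<noteq> 0" using c by (auto simp: \<phi>_def simp del: right_minus_eq)
    then obtain t where t: "t \<in> real_spectrum U e (c *\<^sub>R e - h s)" "\<bar>t\<bar> = c"
      using norm_in_spectrum[of "c *\<^sub>R e - h s"] h_S eq by (auto simp: \<phi>_def)
    then have "c - t \<in> real_spectrum U e (h s)" using spectrum_reflect[OF h_S] by simp
    moreover have "0 \<notin> real_spectrum U e (h s)" using inv[OF that] by (simp add: real_spectrum_def)
    ultimately have "t \<noteq> c" "\<bar>c - t\<bar> < c"
      using spectrum_bound[OF h_S] bound[OF that] by (auto intro: le_less_trans)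
    then show False using t by linarith
  qed
  moreover have "\<phi> 0 \<le> c"
  proof -
    have "h 0 = p" using p by (simp add: h_def D_def)
    then show ?thesis using spectrum_nonneg_iff[of p c] p bound[of 0] by (simp add: \<phi>_def)
  qed
  ultimately have "\<phi> 1 \<le> c"
    using IVT'[of \<phi> 0 c 1] by force
  then have "real_spectrum U e (h 1) \<subseteq> {0..}"
    using spectrum_nonneg_iff[OF h_S, of 1 c] bound[of 1] by (simp add: \<phi>_def)
  then show ?thesis by (simp add: h_def D_def)
qed

text \<open>Adding \<open>\<epsilon> e\<close> makes \<open>p\<close> invertible and keeps it
  positive; the norm criterion survives the limit.\<close>

lemma sandwich_nonneg:
  assumes a: "a \<in> S" and g: "continuous_on (real_spectrum U e a) g"
    and g_pos: "\<And>t. t \<in> real_spectrum U e a \<Longrightarrow> g t > 0"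
    and p: "p \<in> S" "real_spectrum U e p \<subseteq> {0..}"
  defines "d \<equiv> cfc U e g a"
  shows "real_spectrum U e (d * p * d) \<subseteq> {0..}"
proof -
  have d: "d \<in> S" using cfc_S[OF a g] by (simp add: d_def)
  have dpd: "d * p * d \<in> S" using sandwich_S d p by simp
  define K where "K = norm (d * d)"
  \<comment> \<open>The summand \<open>K\<close> makes one \<open>c\<close> large enough for
    \<open>d * (p + \<epsilon> e) * d\<close> with any \<open>\<epsilon> < 1\<close>.\<close>
  define c where "c = norm (d * p * d) + K"
  have "norm (c *\<^sub>R e - d * p * d) \<le> c + \<epsilon> * K" if \<epsilon>: "0 < \<epsilon>" "\<epsilon> < 1" for \<epsilon>
  proof -
    let ?p = "p + \<epsilon> *\<^sub>R e"
    have sp: "t - \<epsilon> \<in> real_spectrum U e p" if "t \<in> real_spectrum U e ?p" for t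
      using that spectrum_shift[of "t - \<epsilon>" p \<epsilon>] by simp
    have "real_spectrum U e ?p \<subseteq> {0..}" "0 \<notin> real_spectrum U e ?p"
      using sp p(2) \<epsilon> by force+
    then have "real_spectrum U e (d * ?p * d) \<subseteq> {0..}"
      unfolding d_def using p by (intro sandwich_nonneg_invertible[OF a g g_pos]) (simp_all add: real_spectrum_def)
    moreover have eq: "d * ?p * d = d * p * d + \<epsilon> *\<^sub>R (d * d)"
      using d by (simp add: algebra_simps)
    moreover have "norm (d * p * d + \<epsilon> *\<^sub>R (d * d)) \<le> c"
    proof -
      have "norm (d * p * d + \<epsilon> *\<^sub>R (d * d)) \<le> norm (d * p * d) + \<epsilon> * K"
        using \<epsilon> norm_triangle_ineq[of "d * p * d" "\<epsilon> *\<^sub>R (d * d)"] by (simp add: K_def)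
      also have "\<epsilon> * K \<le> 1 * K" using \<epsilon> by (intro mult_right_mono) (simp_all add: K_def)
      finally show ?thesis by (simp add: c_def)
    qed
    ultimately have "norm (c *\<^sub>R e - (d * p * d + \<epsilon> *\<^sub>R (d * d))) \<le> c"
      using spectrum_nonneg_iff[of "d * p * d + \<epsilon> *\<^sub>R (d * d)" c] dpd d by simp
    then show ?thesis
      using norm_triangle_ineq[of "c *\<^sub>R e - (d * p * d + \<epsilon> *\<^sub>R (d * d))" "\<epsilon> *\<^sub>R (d * d)"] \<epsilon>
      by (simp add: K_def)
  qed
  then have "eventually (\<lambda>\<epsilon>. norm (c *\<^sub>R e - d * p * d) - c \<le> \<epsilon> * K) (at_right 0)"
    by (auto simp: eventually_at_right_field algebra_simps intro!: exI[of _ 1])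
  moreover have lim: "((\<lambda>\<epsilon>. \<epsilon> * K) \<longlongrightarrow> 0 * K) (at_right 0)"
    by (intro tendsto_intros)
  ultimately have "norm (c *\<^sub>R e - d * p * d) - c \<le> 0 * K"
    using tendsto_lowerbound[OF lim _ trivial_limit_at_right_real] by blast
  then have "norm (c *\<^sub>R e - d * p * d) \<le> c" by simp
  then show ?thesis
    using spectrum_nonneg_iff[OF dpd, of c] by (simp add: c_def K_def)
qed


definition nonneg :: "'a \<Rightarrow> bool" where
  "nonneg x \<longleftrightarrow> x \<in> S \<and> real_spectrum U e x \<subseteq> {0..}"

section \<open>Sandwiches with powers of A\<close>

context
  fixes A :: 'a and \<beta> :: real
  assumes A: "nonneg A" "invertible_in U e A"
begin

lemma A_S: "A \<in> S"
  using A by (simp add: nonneg_def)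

lemma spectrum_A_pos: "t \<in> real_spectrum U e A \<Longrightarrow> t > 0"
  using A by (cases "t = 0") (auto simp: nonneg_def real_spectrum_def)

lemma continuous_on_powr_A: "continuous_on (real_spectrum U e A) (\<lambda>t. t powr r)"
  by (intro continuous_intros) (use spectrum_A_pos in fastforce)

lemma rpow_A_S: "rpow U e A r \<in> S"
  unfolding rpow_def by (rule cfc_S[OF A_S continuous_on_powr_A])

lemma rpow_A_mult: "rpow U e A r * rpow U e A s = rpow U e A (r + s)"
  unfolding rpow_def cfc_mult[OF A_S continuous_on_powr_A continuous_on_powr_A, symmetric]
  by (rule cfc_cong) (simp add: powr_add)

text \<open>\<open>0 powr 0\<close> is 0, so the positivity of the spectrum enters even
  here.\<close>

lemma rpow_A_0: "rpow U e A 0 = e"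
  using cfc_cong[of A "\<lambda>t. t powr 0" "\<lambda>t. 1"] spectrum_A_pos A_S
  by (force simp: rpow_def cfc_const)

lemma rpow_A_sandwich_nonneg:
  assumes "nonneg x"
  shows "nonneg (rpow U e A r * x * rpow U e A r)"
  using assms sandwich_S[OF rpow_A_S] sandwich_nonneg[OF A_S continuous_on_powr_A, where p = x] spectrum_A_pos
  unfolding nonneg_def rpow_def by (simp add: powr_gt_zero less_imp_neq[THEN not_sym])

text \<open>Sandwiching \<open>B - A^\<beta>\<close> between two factors
  \<open>A^(-\<beta>/2)\<close> preserves positivity and produces \<open>X - e\<close>.\<close>

lemma spectrum_relX:
  assumes B: "B \<in> S" and le: "nonneg (B - rpow U e A \<beta>)"
  shows "relX U e \<beta> A B \<in> S" "real_spectrum U e (relX U e \<beta> A B) \<subseteq> {1..}"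
proof -
  let ?d = "rpow U e A (- \<beta> / 2)" and ?X = "relX U e \<beta> A B"
  show "?X \<in> S" unfolding relX_def by (rule sandwich_S[OF rpow_A_S B])
  have "?d * rpow U e A \<beta> * ?d = e" by (simp add: rpow_A_mult rpow_A_0)
  then have "?d * (B - rpow U e A \<beta>) * ?d = ?X - e"
    by (simp add: relX_def left_diff_distrib right_diff_distrib)
  then have "nonneg (?X - e)" using rpow_A_sandwich_nonneg[OF le] by metis
  then have "t - 1 \<ge> 0" if "t \<in> real_spectrum U e ?X" for t
    using spectrum_shift[of t ?X "-1"] that unfolding nonneg_def by force
  then show "real_spectrum U e ?X \<subseteq> {1..}" by force
qed

definition sandwich_cfc :: "'a \<Rightarrow> (real \<Rightarrow> real) \<Rightarrow> 'a" where
  "sandwich_cfc X f = rpow U e A (\<beta> / 2) * cfc U e f X * rpow U e A (\<beta> / 2)"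

lemma sandwich_cfc_mono:
  assumes "X \<in> S" "continuous_on (real_spectrum U e X) f" "continuous_on (real_spectrum U e X) g"
    and "\<And>t. t \<in> real_spectrum U e X \<Longrightarrow> f t \<le> g t"
  shows "nonneg (sandwich_cfc X g - sandwich_cfc X f)"
proof -
  have "continuous_on (real_spectrum U e X) (\<lambda>t. g t - f t)"
    by (intro continuous_intros assms)
  then have "nonneg (cfc U e (\<lambda>t. g t - f t) X)"
    using assms(1,4) by (simp add: nonneg_def cfc_S cfc_nonneg)
  then have "nonneg (sandwich_cfc X (\<lambda>t. g t - f t))"
    unfolding sandwich_cfc_def by (rule rpow_A_sandwich_nonneg)
  also have "sandwich_cfc X (\<lambda>t. g t - f t) = sandwich_cfc X g - sandwich_cfc X f"
    using assms by (simp add: sandwich_cfc_def cfc_diff left_diff_distrib right_diff_distrib)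
  finally show ?thesis .
qed

text \<open>The inverses in I and II are calculi of \<open>e + X\<close> and of
  \<open>X^(1/2) + e\<close>. Uniqueness of inverses, through \<open>invm_cfc\<close>, turns them
  into functions of \<open>X\<close> and avoids a composition rule.\<close>

lemma entropy_terms_eq:
  fixes B
  defines "X \<equiv> relX U e \<beta> A B"
  assumes X: "X \<in> S" and ge: "real_spectrum U e X \<subseteq> {1..}"
  shows "term_I U e \<alpha> \<beta> A B = sandwich_cfc X (\<lambda>t. 2 * ((1 - 2 * inverse (1 + t)) * t powr \<alpha>))"
    and "term_II U e \<alpha> \<beta> A B
      = sandwich_cfc X (\<lambda>t. 4 * t powr \<alpha> - 8 * (t powr \<alpha> * inverse (t powr (1/2) + 1)))"
    and "rel_entropy U e \<alpha> \<beta> A B = sandwich_cfc X (\<lambda>t. t powr \<alpha> * ln t)"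
    and "term_III U e \<alpha> \<beta> A B = sandwich_cfc X (\<lambda>t. t powr (\<alpha> + 1/2) - t powr (\<alpha> - 1/2))"
    and "term_V U e \<alpha> \<beta> A B = sandwich_cfc X (\<lambda>t. (1/2) * (t powr (\<alpha> + 1) - t powr (\<alpha> - 1)))"
proof -
  have pos: "t > 0" if "t \<in> real_spectrum U e X" for t using ge that by force
  have c_powr: "continuous_on (real_spectrum U e X) (\<lambda>t. t powr r)" for r
    by (intro continuous_intros) (use pos in fastforce)
  have c_ln: "continuous_on (real_spectrum U e X) ln"
    by (intro continuous_intros) (use pos in fastforce)
  have c_inv1: "continuous_on (real_spectrum U e X) (\<lambda>t. inverse (1 + t))"
    by (intro continuous_intros) (use pos in fastforce)
  have nz: "t powr (1/2) + 1 \<noteq> 0" for t :: real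
    using powr_ge_zero[of t "1/2"] by linarith
  have c_inv2: "continuous_on (real_spectrum U e X) (\<lambda>t. inverse (t powr (1/2) + 1))"
    by (intro continuous_intros c_powr) (simp add: nz)
  have geo: "geo_mean U e \<gamma> \<beta> A B = sandwich_cfc X (\<lambda>t. t powr \<gamma>)" for \<gamma>
    by (simp add: geo_mean_def Let_def X_def sandwich_cfc_def rpow_def)
  note cs = c_powr c_ln c_inv1 c_inv2 continuous_on_mult continuous_on_diff continuous_on_const
  have inv1: "invm U e (e + X) = cfc U e (\<lambda>t. inverse (1 + t)) X"
  proof -
    have "e + X = cfc U e (\<lambda>t. 1 + t) X"
      using X cfc_add[of X "\<lambda>t. 1" "\<lambda>t. t"] by (simp add: cfc_const cfc_id continuous_on_id)
    then show ?thesis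
      using invm_cfc[OF X, of "\<lambda>t. 1 + t"] pos by (force intro: continuous_intros)
  qed
  have inv2: "invm U e (rpow U e X (1/2) + e) = cfc U e (\<lambda>t. inverse (t powr (1/2) + 1)) X"
  proof -
    have "rpow U e X (1/2) + e = cfc U e (\<lambda>t. t powr (1/2) + 1) X"
      using X cfc_add[OF X c_powr, of "\<lambda>t. 1" "1/2"] by (simp add: cfc_const rpow_def)
    moreover have "continuous_on (real_spectrum U e X) (\<lambda>t. t powr (1/2) + 1)"
      by (intro continuous_on_add c_powr continuous_on_const)
    ultimately show ?thesis
      using invm_cfc[OF X, of "\<lambda>t. t powr (1/2) + 1"] nz by simp
  qed
  have "e - 2 *\<^sub>R cfc U e (\<lambda>t. inverse (1 + t)) X = cfc U e (\<lambda>t. 1 - 2 * inverse (1 + t)) X"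
    using X by (simp add: cfc_diff cfc_scaleR cfc_const cs)
  then show "term_I U e \<alpha> \<beta> A B = sandwich_cfc X (\<lambda>t. 2 * ((1 - 2 * inverse (1 + t)) * t powr \<alpha>))"
    unfolding term_I_def Let_def X_def[symmetric] inv1
    using X by (simp add: rpow_def sandwich_cfc_def cfc_scaleR cfc_mult cs)
  show "term_II U e \<alpha> \<beta> A B
      = sandwich_cfc X (\<lambda>t. 4 * t powr \<alpha> - 8 * (t powr \<alpha> * inverse (t powr (1/2) + 1)))"
    unfolding term_II_def Let_def X_def[symmetric] inv2 geo
    using X by (simp add: rpow_def sandwich_cfc_def cfc_scaleR cfc_mult cfc_diff cs
        left_diff_distrib right_diff_distrib)
  show "rel_entropy U e \<alpha> \<beta> A B = sandwich_cfc X (\<lambda>t. t powr \<alpha> * ln t)"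
    unfolding rel_entropy_def Let_def X_def[symmetric]
    using X by (simp add: rpow_def logm_def sandwich_cfc_def cfc_mult cs)
  show "term_III U e \<alpha> \<beta> A B = sandwich_cfc X (\<lambda>t. t powr (\<alpha> + 1/2) - t powr (\<alpha> - 1/2))"
    unfolding term_III_def geo
    using X by (simp add: sandwich_cfc_def cfc_diff cs left_diff_distrib right_diff_distrib)
  show "term_V U e \<alpha> \<beta> A B = sandwich_cfc X (\<lambda>t. (1/2) * (t powr (\<alpha> + 1) - t powr (\<alpha> - 1)))"
    unfolding term_V_def geo cfc_scaleR
    using X cfc_scaleR[OF X, of "\<lambda>t. t powr (\<alpha> + 1) - t powr (\<alpha> - 1)" "1/2"]
    by (simp add: sandwich_cfc_def cfc_diff cs left_diff_distrib right_diff_distrib)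
qed

lemma entropy_chain:
  assumes B: "B \<in> S" and le: "nonneg (B - rpow U e A \<beta>)"
  shows "nonneg (term_II U e \<alpha> \<beta> A B - term_I U e \<alpha> \<beta> A B)"
    and "nonneg (rel_entropy U e \<alpha> \<beta> A B - term_II U e \<alpha> \<beta> A B)"
    and "nonneg (term_III U e \<alpha> \<beta> A B - rel_entropy U e \<alpha> \<beta> A B)"
    and "nonneg (term_V U e \<alpha> \<beta> A B - term_III U e \<alpha> \<beta> A B)"
proof -
  note X = spectrum_relX[OF B le]
  note eqs = entropy_terms_eq[OF X]
  have ge: "1 \<le> t" if "t \<in> real_spectrum U e (relX U e \<beta> A B)" for t
    using X(2) that by force
  have nz: "t \<noteq> 0" "1 + t \<noteq> 0" "t powr (1/2) + 1 \<noteq> 0" if "t \<in> real_spectrum U e (relX U e \<beta> A B)" for t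
    using ge[OF that] powr_ge_zero[of t "1/2"] by linarith+
  have cont: "continuous_on (real_spectrum U e (relX U e \<beta> A B)) (\<lambda>t. 2 * ((1 - 2 * inverse (1 + t)) * t powr \<alpha>))"
    "continuous_on (real_spectrum U e (relX U e \<beta> A B))
      (\<lambda>t. 4 * t powr \<alpha> - 8 * (t powr \<alpha> * inverse (t powr (1/2) + 1)))"
    "continuous_on (real_spectrum U e (relX U e \<beta> A B)) (\<lambda>t. t powr \<alpha> * ln t)"
    "continuous_on (real_spectrum U e (relX U e \<beta> A B)) (\<lambda>t. t powr (\<alpha> + 1/2) - t powr (\<alpha> - 1/2))"
    "continuous_on (real_spectrum U e (relX U e \<beta> A B)) (\<lambda>t. (1/2) * (t powr (\<alpha> + 1) - t powr (\<alpha> - 1)))"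
    by (intro continuous_intros; use nz in blast)+
  note bounds = log_bounds_chain[OF ge, of _ \<alpha>]
  show "nonneg (term_II U e \<alpha> \<beta> A B - term_I U e \<alpha> \<beta> A B)"
    unfolding eqs by (rule sandwich_cfc_mono[OF X(1) cont(1,2) bounds(1)])
  show "nonneg (rel_entropy U e \<alpha> \<beta> A B - term_II U e \<alpha> \<beta> A B)"
    unfolding eqs by (rule sandwich_cfc_mono[OF X(1) cont(2,3) bounds(2)])
  show "nonneg (term_III U e \<alpha> \<beta> A B - rel_entropy U e \<alpha> \<beta> A B)"
    unfolding eqs by (rule sandwich_cfc_mono[OF X(1) cont(3,4) bounds(3)])
  show "nonneg (term_V U e \<alpha> \<beta> A B - term_III U e \<alpha> \<beta> A B)"
    unfolding eqs by (rule sandwich_cfc_mono[OF X(1) cont(4,5) bounds(4)])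
qed

end

end

section \<open>The three kinds of algebras\<close>

instance banach_star_algebra \<subseteq> banach ..

context
  fixes e :: "'a::banach_star_algebra"
  assumes e: "algebra_unit e"
begin

lemma unit_simps: "e * x = x" "x * e = x"
  using e by (simp_all add: algebra_unit_def)

lemma star_unit: "star e = e"
proof -
  have "star e = star e * star (star e)" by (simp only: star_star unit_simps)
  also have "\<dots> = star (star e * e)" by (simp only: star_mult)
  also have "\<dots> = e" by (simp only: star_star unit_simps)
  finally show ?thesis .
qed

end

lemma norm_star:
  fixes x :: "'a::banach_star_algebra"
  shows "norm (star x) = norm x"
proof -
  have le: "norm x \<le> norm (star x)" for x :: 'a
  proof (cases "x = 0")
    case False
    have "(norm x)\<^sup>2 \<le> norm (star x) * norm x"
      using norm_mult_ineq[of "star x" x] by (simp add: cstar_identity)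
    then show ?thesis using False by (simp add: power2_eq_square)
  qed simp
  show ?thesis using le[of x] le[of "star x"] by (simp add: star_star)
qed

lemma bounded_linear_star: "bounded_linear (star :: 'a::banach_star_algebra \<Rightarrow> 'a)"
  by (rule bounded_linear_intro[where K=1]) (simp_all add: star_add star_scaleR norm_star)

text \<open>Complex and real C*-algebras differ only in the reason why \<open>e + x * x\<close> is
  invertible; the other axioms are settled here for both.\<close>

lemma sa_algebra_selfadjoint:
  fixes e :: "'a::banach_star_algebra"
  assumes e: "algebra_unit e"
    and inv: "\<And>x. star x = x \<Longrightarrow> invertible_in UNIV e (e + x * x)"
  shows "sa_algebra {x. star x = x} UNIV e"
proof
  note lin = bounded_linear.linear[OF bounded_linear_star[where 'a='a]]
  show "subspace {x :: 'a. star x = x}"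
    by (rule subspaceI) (simp_all add: star_add star_scaleR linear_0[OF lin])
  show "closed {x :: 'a. star x = x}"
    by (intro closed_Collect_eq continuous_on_id linear_continuous_on bounded_linear_star)
  fix x :: 'a assume x: "x \<in> {x. star x = x}"
  show "norm (x * x) = (norm x)\<^sup>2" using x cstar_identity[of x] by simp
  show "invertible_in UNIV e (e + x * x)" using x inv by simp
  fix b assume b: "x * b = e" "b * x = e"
  have "star b * x = star (x * b)" using x by (simp add: star_mult)
  then have "star b * x = e" by (simp add: b star_unit[OF e])
  moreover have "star b * x * b = star b" by (simp add: mult.assoc b unit_simps[OF e])
  ultimately show "b \<in> {x. star x = x}" by (simp add: unit_simps[OF e])
qed (auto simp: star_unit[OF e] unit_simps[OF e] star_mult mult.assoc)

subsection \<open>Complex C*-algebras\<close>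

context
  fixes e :: "'a::cstar_algebra"
  assumes e: "algebra_unit e"
begin

private abbreviation j :: "'a \<Rightarrow> 'a" where "j x \<equiv> \<i> *\<^sub>C x"

private lemma j_simps:
  "j (x + y) = j x + j y" "j (x - y) = j x - j y" "j (- x) = - j x" "j (j x) = - x"
  "j x * y = j (x * y)" "x * j y = j (x * y)" "star (j x) = - j (star x)" "norm (j x) = norm x"
  "j (r *\<^sub>R x) = r *\<^sub>R j x"
proof -
  have neg: "(- c) *\<^sub>C z = - (c *\<^sub>C z)" for c and z :: 'a
    using scaleC_scaleC[of c "-1" z] scaleR_scaleC[of "-1" z, symmetric] by (simp add: scaleC_minus_right)
  show "j (j x) = - x" "star (j x) = - j (star x)"
    using neg[of 1 x] scaleR_scaleC[of 1 x] by (simp_all add: scaleC_scaleC star_scaleC neg)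
  show "j (r *\<^sub>R x) = r *\<^sub>R j x" by (simp add: scaleR_scaleC scaleC_scaleC mult.commute)
qed (simp_all add: scaleC_add_right scaleC_diff_right scaleC_minus_right mult_scaleC_left mult_scaleC_right norm_scaleC)

text \<open>If \<open>s + \<i>x\<close> were not invertible, neither would be the shift of \<open>\<i>x\<close> by any other real
  number, and a large shift is dominated by the scalar.\<close>

lemma invertible_imaginary_shift:
  fixes x :: 'a
  assumes x: "star x = x" and s: "s \<noteq> 0"
  shows "invertible_in UNIV e (s *\<^sub>R e + \<i> *\<^sub>C x)"
proof -
  note u = unit_simps[OF e] and su = star_unit[OF e]
  \<comment> \<open>\<open>s e + \<i> x\<close> equals \<open>w e + \<i> y\<close>, and
    \<open>2 s t = (norm x)^2 + 1\<close> gives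
    \<open>w^2 > (norm x)^2 + t^2 \<ge> (norm y)^2\<close>.\<close>
  define t where "t = ((norm x)\<^sup>2 + 1) / (2 * s)"
  define w where "w = s + t"
  define y where "y = x + t *\<^sub>R j e"
  have "norm e = (norm e)\<^sup>2" using cstar_identity[of e] by (simp add: u su)
  then have e1: "norm e \<le> 1" by (cases "norm e = 0") (auto simp: power2_eq_square)
  have "star y = x - t *\<^sub>R j e" by (simp add: y_def star_add star_scaleR x su j_simps)
  then have "star y * y = x * x + t\<^sup>2 *\<^sub>R e"
    by (simp add: y_def distrib_left left_diff_distrib scaleR_add_right j_simps u power2_eq_square)
  then have "(norm y)\<^sup>2 = norm (x * x + t\<^sup>2 *\<^sub>R e)" by (simp flip: cstar_identity)
  also have "\<dots> \<le> norm (x * x) + t\<^sup>2 * norm e" using norm_triangle_ineq[of "x * x" "t\<^sup>2 *\<^sub>R e"] by simp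
  also have "\<dots> \<le> (norm x)\<^sup>2 + t\<^sup>2 * 1"
    using norm_mult_ineq[of x x] e1 by (intro add_mono mult_left_mono) (simp_all add: power2_eq_square)
  also have "\<dots> < w\<^sup>2"
  proof -
    have "2 * s * t = (norm x)\<^sup>2 + 1" using s by (simp add: t_def)
    then show ?thesis by (simp add: w_def power2_sum add_nonneg_pos)
  qed
  finally have yw: "norm y < \<bar>w\<bar>" using power_less_imp_less_base[of "norm y" 2 "\<bar>w\<bar>"] by simp
  then have w: "w \<noteq> 0" using norm_ge_zero[of y] by auto
  define n where "n = - ((1 / w) *\<^sub>R j y)"
  have "norm n < 1" using yw w by (simp add: n_def j_simps)
  then obtain v where v: "(e - n) * v = e" "v * (e - n) = e"
    using neumann_series[of e n UNIV] by (auto simp: u)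
  have "w *\<^sub>R (e - n) = s *\<^sub>R e + j x"
    using w by (simp add: n_def y_def w_def j_simps scaleR_add_left scaleR_add_right)
  then have "s *\<^sub>R e + j x = w *\<^sub>R (e - n)" by simp
  then show ?thesis
    using v w by (auto simp: invertible_in_def intro!: exI[of _ "(1 / w) *\<^sub>R v"])
qed

lemma cstar_one_plus_square_inv:
  fixes x :: 'a
  assumes x: "star x = x"
  shows "invertible_in UNIV e (e + x * x)"
proof -
  note u = unit_simps[OF e]
  obtain v where v: "(e + j x) * v = e" "v * (e + j x) = e"
    using invertible_imaginary_shift[OF x, of 1] by (auto simp: invertible_in_def)
  obtain v' where v': "(- e + j x) * v' = e" "v' * (- e + j x) = e"
    using invertible_imaginary_shift[OF x, of "-1"] by (auto simp: invertible_in_def)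
  have eq: "e + x * x = - ((e + j x) * (- e + j x))"
    by (simp add: algebra_simps u j_simps)
  have "(e + j x) * (- e + j x) * (v' * v) = (e + j x) * ((- e + j x) * v') * v"
    "v' * v * ((e + j x) * (- e + j x)) = v' * (v * (e + j x)) * (- e + j x)"
    by (simp_all only: mult.assoc)
  then have "(e + j x) * (- e + j x) * (v' * v) = e" "v' * v * ((e + j x) * (- e + j x)) = e"
    by (simp_all only: v v' u)
  then show ?thesis
    unfolding invertible_in_def eq by (intro bexI[of _ "- (v' * v)"]) simp_all
qed

lemma sa_algebra_cstar: "sa_algebra {x. star x = x} UNIV e"
  by (rule sa_algebra_selfadjoint[OF e cstar_one_plus_square_inv])

text \<open>Only non-real \<open>z\<close> need an argument: \<open>a - z e\<close> is
  \<open>- \<i>\<close> times an element \<open>s e + \<i> x\<close> with \<open>s = Im z\<close>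
  and selfadjoint \<open>x\<close>.\<close>

lemma cstar_positive_iff_nonneg: "cstar_positive e a \<longleftrightarrow> sa_algebra.nonneg {x. star x = x} UNIV e a"
proof -
  have "spectrum e a \<subseteq> \<real>\<^sub>\<ge>\<^sub>0 \<longleftrightarrow> real_spectrum UNIV e a \<subseteq> {0..}" if a: "star a = a"
  proof
    assume sp: "spectrum e a \<subseteq> \<real>\<^sub>\<ge>\<^sub>0"
    show "real_spectrum UNIV e a \<subseteq> {0..}"
    proof
      fix t assume "t \<in> real_spectrum UNIV e a"
      then have "complex_of_real t \<in> spectrum e a"
        by (simp add: spectrum_def real_spectrum_def scaleR_scaleC)
      then show "t \<in> {0..}" using sp by auto
    qed
  next
    assume sp: "real_spectrum UNIV e a \<subseteq> {0..}"
    show "spectrum e a \<subseteq> \<real>\<^sub>\<ge>\<^sub>0"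
    proof
      fix z assume z: "z \<in> spectrum e a"
      have ze: "z *\<^sub>C e = Re z *\<^sub>R e + Im z *\<^sub>R j e"
      proof -
        have "z = of_real (Re z) + of_real (Im z) * \<i>" by (simp add: complex_eq_iff)
        then show ?thesis by (metis scaleC_add_left scaleC_scaleC scaleR_scaleC)
      qed
      have "Im z = 0"
      proof (rule ccontr)
        assume "Im z \<noteq> 0"
        moreover have "star (a - Re z *\<^sub>R e) = a - Re z *\<^sub>R e"
          using a by (simp add: linear_diff[OF bounded_linear.linear[OF bounded_linear_star]]
              star_scaleR star_unit[OF e])
        ultimately obtain v where v: "(Im z *\<^sub>R e + j (a - Re z *\<^sub>R e)) * v = e"
            "v * (Im z *\<^sub>R e + j (a - Re z *\<^sub>R e)) = e"
          using invertible_imaginary_shift by (auto simp: invertible_in_def)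
        have j_v: "- j q * j v = q * v" "j v * (- j q) = v * q" for q v :: 'a
          by (simp_all add: j_simps)
        have "a - z *\<^sub>C e = - j (Im z *\<^sub>R e + j (a - Re z *\<^sub>R e))"
          by (simp add: ze j_simps)
        then have "(a - z *\<^sub>C e) * j v = e" "j v * (a - z *\<^sub>C e) = e"
          by (simp_all only: j_v v)
        then show False using z by (auto simp: spectrum_def invertible_in_def)
      qed
      moreover from this have "Re z \<in> real_spectrum UNIV e a"
        using z by (simp add: spectrum_def real_spectrum_def ze)
      ultimately show "z \<in> \<real>\<^sub>\<ge>\<^sub>0" using sp by (auto simp: complex_nonneg_Reals_iff)
    qed
  qed
  then show ?thesis
    by (auto simp: cstar_positive_def sa_algebra.nonneg_def[OF sa_algebra_cstar])
qed

end

subsection \<open>Real C*-algebras\<close>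

context
  fixes e :: "'a::real_cstar_algebra"
  assumes e: "algebra_unit e"
begin

text \<open>The class axiom says that \<open>e + y\<close> inverts
  \<open>e + star x * x\<close>.\<close>

lemma sa_algebra_real_cstar: "sa_algebra {x. star x = x} UNIV e"
proof (rule sa_algebra_selfadjoint[OF e])
  fix x :: 'a assume x: "star x = x"
  note u = unit_simps[OF e]
  obtain y where y: "x * x + y + x * x * y = 0" "x * x + y + y * (x * x) = 0"
    using one_plus_square_invertible[of x] x by auto
  have "(e + x * x) * (e + y) = e + (x * x + y + x * x * y)"
    "(e + y) * (e + x * x) = e + (x * x + y + y * (x * x))"
    by (simp_all add: distrib_left distrib_right u)
  then show "invertible_in UNIV e (e + x * x)"
    unfolding invertible_in_def y by auto
qed

text \<open>At a real point \<open>t\<close> the quadratic defining the spectrum is the square of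
  \<open>a - t e\<close>, invertible together with it; at a non-real point it is always
  invertible.\<close>

lemma real_cstar_positive_iff_nonneg:
  "real_cstar_positive e a \<longleftrightarrow> sa_algebra.nonneg {x. star x = x} UNIV e a"
proof -
  interpret sa_algebra "{x :: 'a. star x = x}" UNIV e by (rule sa_algebra_real_cstar)
  have "real_alg_spectrum e a \<subseteq> \<real>\<^sub>\<ge>\<^sub>0 \<longleftrightarrow> real_spectrum UNIV e a \<subseteq> {0..}" if a: "star a = a"
  proof -
    have "a - r *\<^sub>R e \<in> {x. star x = x}" for r
      by (intro S_closed e_S) (use a in simp)
    then have shift_S: "star (a - r *\<^sub>R e) = a - r *\<^sub>R e" for r by simp
    have iff: "z \<in> real_alg_spectrum e a \<longleftrightarrow> Im z = 0 \<and> Re z \<in> real_spectrum UNIV e a" for z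
    proof (cases "Im z = 0")
      case True
      have "invertible_in UNIV e ((a - Re z *\<^sub>R e) * (a - Re z *\<^sub>R e)) \<longleftrightarrow>
          invertible_in UNIV e (a - Re z *\<^sub>R e)"
        using invertible_in_mult[of "a - Re z *\<^sub>R e" "a - Re z *\<^sub>R e"]
          invertible_in_factor[of "a - Re z *\<^sub>R e" "a - Re z *\<^sub>R e"] shift_S by auto
      then show ?thesis using True by (simp add: real_alg_spectrum_def real_spectrum_def)
    next
      case False
      then show ?thesis using invertible_in_quadratic[of a "Im z" "Re z"] a
        by (simp add: real_alg_spectrum_def)
    qed
    show ?thesis
    proof
      assume sp: "real_alg_spectrum e a \<subseteq> \<real>\<^sub>\<ge>\<^sub>0"
      show "real_spectrum UNIV e a \<subseteq> {0..}"
      proof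
        fix t assume "t \<in> real_spectrum UNIV e a"
        then have "complex_of_real t \<in> real_alg_spectrum e a" by (simp add: iff)
        then show "t \<in> {0..}" using sp by auto
      qed
    qed (auto simp: iff complex_nonneg_Reals_iff)
  qed
  then show ?thesis by (auto simp: real_cstar_positive_def nonneg_def)
qed

end

subsection \<open>JC-algebras\<close>

lemma bop_apply_simps:
  "bop_apply (S + T) x = bop_apply S x + bop_apply T x"
  "bop_apply (S - T) x = bop_apply S x - bop_apply T x"
  "bop_apply (r *\<^sub>R T) x = r *\<^sub>R bop_apply T x"
  "bop_apply (S * T) x = bop_apply S (bop_apply T x)"
  "bop_apply T (x + y) = bop_apply T x + bop_apply T y"
  "bop_apply T (x - y) = bop_apply T x - bop_apply T y"
  by (transfer; simp add: blinfun.bilinear_simps)+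

lemma norm_bop_apply: "norm (bop_apply T x) \<le> norm T * norm x"
  by transfer (rule norm_blinfun)

lemma norm_bop_le: "0 \<le> c \<Longrightarrow> (\<And>x. norm (bop_apply T x) \<le> c * norm x) \<Longrightarrow> norm T \<le> c"
  by transfer (rule norm_blinfun_bound)

instance complex_hilbert_space \<subseteq> banach ..

text \<open>Complex homogeneity passes to pointwise limits, so the complex linear operators are
  closed among the bounded real linear ones.\<close>

instance bop :: (complex_hilbert_space) banach
proof
  fix X :: "nat \<Rightarrow> 'a bop"
  assume "Cauchy X"
  then have "Cauchy (\<lambda>n. Rep_bop (X n))"
    by (simp add: Cauchy_def dist_norm norm_bop.rep_eq minus_bop.rep_eq)
  then obtain L where L: "(\<lambda>n. Rep_bop (X n)) \<longlonglongrightarrow> L"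
    by (auto simp: Cauchy_convergent_iff convergent_def)
  have lim: "(\<lambda>n. blinfun_apply (Rep_bop (X n)) x) \<longlonglongrightarrow> blinfun_apply L x" for x
    by (intro tendsto_intros L)
  have "bounded_linear (\<lambda>x. c *\<^sub>C (x :: 'a))" for c
    by (rule bounded_linear_intro[where K="cmod c"])
      (simp_all add: scaleC_add_right scaleR_scaleC scaleC_scaleC norm_scaleC mult.commute)
  then have clim: "(\<lambda>n. c *\<^sub>C blinfun_apply (Rep_bop (X n)) x) \<longlonglongrightarrow> c *\<^sub>C blinfun_apply L x" for c x
    using lim bounded_linear.tendsto by blast
  have comm: "blinfun_apply (Rep_bop (X n)) (c *\<^sub>C x) = c *\<^sub>C blinfun_apply (Rep_bop (X n)) x" for n c x
    using Rep_bop[of "X n"] by simp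
  have "blinfun_apply L (c *\<^sub>C x) = c *\<^sub>C blinfun_apply L x" for c x
    by (rule LIMSEQ_unique[OF lim[of "c *\<^sub>C x", unfolded comm] clim])
  then have "Rep_bop (Abs_bop L) = L" by (intro Abs_bop_inverse) simp
  then have "X \<longlonglongrightarrow> Abs_bop L"
    using L by (simp add: LIMSEQ_def dist_norm norm_bop.rep_eq minus_bop.rep_eq)
  then show "convergent X" by (auto simp: convergent_def)
qed

text \<open>A real inner product with the same norm. It suffices because the quadratic form of a
  selfadjoint operator is real.\<close>

definition rinner :: "'h::complex_hilbert_space \<Rightarrow> 'h \<Rightarrow> real" where
  "rinner x y = Re (cinner x y)"

lemma rinner_commute: "rinner x y = rinner y x"
  using cinner_commute[of x y] by (simp add: rinner_def)

lemma rinner_self: "rinner x x = (norm x)\<^sup>2"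
  by (simp add: rinner_def cinner_self del: of_real_power)

lemma rinner_add_left: "rinner (x + y) z = rinner x z + rinner y z"
  by (simp add: rinner_def cinner_add_left)

lemma rinner_scaleR_left: "rinner (r *\<^sub>R x) z = r * rinner x z"
  by (simp add: rinner_def scaleR_scaleC cinner_scaleC_left)

lemma rinner_diff_left: "rinner (x - y) z = rinner x z - rinner y z"
  using rinner_add_left[of "x - y" y z] by simp

lemma rinner_add_right: "rinner z (x + y) = rinner z x + rinner z y"
  by (simp add: rinner_commute[of z] rinner_add_left)

lemma rinner_diff_right: "rinner z (x - y) = rinner z x - rinner z y"
  by (simp add: rinner_commute[of z] rinner_diff_left)

lemma rinner_scaleR_right: "rinner z (r *\<^sub>R x) = r * rinner z x"
  by (simp add: rinner_commute[of z] rinner_scaleR_left)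

lemma norm_diff_square: "(norm (x - y))\<^sup>2 = (norm x)\<^sup>2 + (norm y)\<^sup>2 - 2 * rinner x y"
  by (simp add: rinner_self[symmetric] rinner_diff_left rinner_diff_right rinner_commute[of y x])

lemma norm_add_square: "(norm (x + y))\<^sup>2 = (norm x)\<^sup>2 + (norm y)\<^sup>2 + 2 * rinner x y"
  by (simp add: rinner_self[symmetric] rinner_add_left rinner_add_right rinner_commute[of y x])

text \<open>Cauchy-Schwarz by squaring the reverse triangle inequality, which comes with the
  norm.\<close>

lemma rinner_le: "rinner x y \<le> norm x * norm y"
proof -
  have "\<bar>norm x - norm y\<bar>\<^sup>2 \<le> (norm (x - y))\<^sup>2"
    by (intro power_mono norm_triangle_ineq3) simp
  then show ?thesis by (simp add: norm_diff_square power2_diff)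
qed

lemma selfadjoint_op_rinner: "selfadjoint_op T \<Longrightarrow> rinner (bop_apply T x) y = rinner x (bop_apply T y)"
  by (simp add: selfadjoint_op_def rinner_def)

lemma positive_op_iff_rinner:
  assumes "selfadjoint_op T"
  shows "positive_op T \<longleftrightarrow> (\<forall>x. 0 \<le> rinner (bop_apply T x) x)"
proof -
  have "cinner (bop_apply T x) x = cnj (cinner (bop_apply T x) x)" for x
    using assms cinner_commute[of "bop_apply T x" x] by (simp add: selfadjoint_op_def)
  then have "Im (cinner (bop_apply T x) x) = 0" for x
    by (metis complex_cnj_cancel_iff cnj.simps(2) equal_neg_zero)
  then show ?thesis by (simp add: positive_op_def rinner_def complex_nonneg_Reals_iff)
qed

lemma norm_square_selfadjoint_op:
  assumes "selfadjoint_op T"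
  shows "norm (T * T) = (norm T)\<^sup>2"
proof (rule antisym)
  show "norm (T * T) \<le> (norm T)\<^sup>2" using norm_mult_ineq[of T T] by (simp add: power2_eq_square)
  have "norm (bop_apply T x) \<le> sqrt (norm (T * T)) * norm x" for x
  proof (rule power2_le_imp_le)
    have "(norm (bop_apply T x))\<^sup>2 = rinner (bop_apply (T * T) x) x"
      using selfadjoint_op_rinner[OF assms, of "bop_apply T x" x] by (simp add: rinner_self[symmetric] bop_apply_simps)
    also have "\<dots> \<le> norm (bop_apply (T * T) x) * norm x" by (rule rinner_le)
    also have "\<dots> \<le> norm (T * T) * norm x * norm x" by (intro mult_right_mono norm_bop_apply) simp
    finally show "(norm (bop_apply T x))\<^sup>2 \<le> (sqrt (norm (T * T)) * norm x)\<^sup>2"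
      by (simp add: power_mult_distrib power2_eq_square[of "norm x"])
  qed simp
  then have "norm T \<le> sqrt (norm (T * T))" by (intro norm_bop_le) simp_all
  then show "(norm T)\<^sup>2 \<le> norm (T * T)" using power_mono[of "norm T" _ 2] by fastforce
qed

lemma norm_le_numerical_radius:
  assumes T: "selfadjoint_op T" and c: "0 \<le> c"
    and le: "\<And>x. \<bar>rinner (bop_apply T x) x\<bar> \<le> c * (norm x)\<^sup>2"
  shows "norm T \<le> c"
proof (rule norm_bop_le[OF c])
  fix x
  show "norm (bop_apply T x) \<le> c * norm x"
  proof (cases "bop_apply T x = 0")
    case False
    let ?Tx = "bop_apply T x"
    have "x \<noteq> 0" using norm_bop_apply[of T x] False by auto
    \<comment> \<open>\<open>y\<close> points along \<open>T x\<close> and has the length of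
      \<open>x\<close>; polarization and the parallelogram law then bound \<open>norm (T x)\<close>
      by quadratic forms.\<close>
    define y where "y = (norm x / norm ?Tx) *\<^sub>R ?Tx"
    have ny: "norm y = norm x" using False by (simp add: y_def)
    have "rinner ?Tx y = norm x * norm ?Tx"
      using False by (simp add: y_def rinner_scaleR_right rinner_self power2_eq_square)
    then have "4 * (norm x * norm ?Tx) = rinner (bop_apply T (x + y)) (x + y) - rinner (bop_apply T (x - y)) (x - y)"
      using selfadjoint_op_rinner[OF T, of y x] rinner_commute[of y ?Tx]
      by (simp add: bop_apply_simps rinner_add_left rinner_add_right rinner_diff_left rinner_diff_right)
    also have "\<dots> \<le> c * (norm (x + y))\<^sup>2 + c * (norm (x - y))\<^sup>2"
      using le[of "x + y"] le[of "x - y"] by linarith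
    also have "\<dots> = c * (4 * (norm x)\<^sup>2)"
      unfolding distrib_left[symmetric] norm_add_square norm_diff_square ny by simp
    also have "\<dots> = 4 * (norm x * (c * norm x))" by (simp add: power2_eq_square)
    finally show ?thesis using \<open>x \<noteq> 0\<close> by simp
  qed (use c in simp)
qed

section \<open>From operators to the abstract setting\<close>

context
  fixes J :: "'h::complex_hilbert_space bop set" and e :: "'h bop"
  assumes J: "jc_algebra J" and e: "jordan_unit J e"
begin

lemma jc_closed:
  "S \<in> J \<Longrightarrow> T \<in> J \<Longrightarrow> S + T \<in> J" "S \<in> J \<Longrightarrow> T \<in> J \<Longrightarrow> S - T \<in> J" "T \<in> J \<Longrightarrow> r *\<^sub>R T \<in> J"
  "S \<in> J \<Longrightarrow> T \<in> J \<Longrightarrow> jordan_prod S T \<in> J" "T \<in> J \<Longrightarrow> selfadjoint_op T"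
  using J by (auto simp: jc_algebra_def subspace_add subspace_diff subspace_scale)

text \<open>A Jordan unit is a unit for the operator product on \<open>J\<close>: multiplying
  \<open>e T + T e = 2 T\<close> by the idempotent \<open>e\<close> from either side gives
  \<open>e T = e T e = T e\<close>.\<close>

lemma jc_unit: "e \<in> J" "T \<in> J \<Longrightarrow> e * T = T" "T \<in> J \<Longrightarrow> T * e = T"
proof -
  show eJ: "e \<in> J" using e by (simp add: jordan_unit_def)
  have jp: "e * T + T * e = 2 *\<^sub>R T" if "T \<in> J" for T
  proof -
    have "2 *\<^sub>R jordan_prod e T = 2 *\<^sub>R T" using e that by (simp add: jordan_unit_def)
    then show ?thesis by (simp add: jordan_prod_def)
  qed
  have ee: "e * e = e" using jp[OF eJ] by (simp add: scaleR_2[symmetric])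
  assume T: "T \<in> J"
  have "e * (e * T + T * e) = e * (2 *\<^sub>R T)" "(e * T + T * e) * e = (2 *\<^sub>R T) * e"
    by (simp_all only: jp[OF T])
  then have "e * T * e = e * T" "e * T * e = T * e"
    by (simp_all add: distrib_left distrib_right scaleR_2 ee mult.assoc) (simp_all add: ee flip: mult.assoc)
  then have "e * T = T * e" by simp
  then have "2 *\<^sub>R (e * T) = 2 *\<^sub>R T" using jp[OF T] by (simp add: scaleR_2)
  then show "e * T = T" "T * e = T" using \<open>e * T = T * e\<close> by simp_all
qed

lemma jc_mult:
  assumes "S \<in> J" "T \<in> J" "S * T = T * S"
  shows "S * T \<in> J"
  using jc_closed(4)[OF assms(1,2)] assms(3) by (simp add: jordan_prod_def scaleR_2[symmetric])

lemma jc_sandwich: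
  assumes "S \<in> J" "T \<in> J"
  shows "S * T * S \<in> J"
proof -
  have SS: "S * S \<in> J" using jc_mult assms by simp
  have "2 *\<^sub>R jordan_prod (jordan_prod S T) S - jordan_prod (S * S) T \<in> J"
    using assms SS by (intro jc_closed)
  also have "2 *\<^sub>R jordan_prod (jordan_prod S T) S - jordan_prod (S * S) T = S * T * S"
    by (simp add: jordan_prod_def algebra_simps scaleR_add_left[symmetric])
  finally show ?thesis .
qed

text \<open>\<open>e\<close> is an orthogonal projection, possibly a proper one.\<close>

lemma rinner_unit: "rinner (bop_apply e x) x = (norm (bop_apply e x))\<^sup>2"
  using selfadjoint_op_rinner[OF jc_closed(5)[OF jc_unit(1)], of "bop_apply e x" x]
  by (simp add: rinner_self flip: bop_apply_simps(4)) (simp add: jc_unit)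

lemma norm_jc_unit: "norm (bop_apply e x) \<le> norm x"
proof -
  have "norm (bop_apply e x) * norm (bop_apply e x) \<le> norm (bop_apply e x) * norm x"
    using rinner_le[of "bop_apply e x" x] by (simp add: rinner_unit power2_eq_square)
  then show ?thesis by (cases "bop_apply e x = 0") simp_all
qed

lemma jc_apply_unit: "T \<in> J \<Longrightarrow> bop_apply T (bop_apply e x) = bop_apply T x"
  by (simp flip: bop_apply_simps(4) add: jc_unit)

text \<open>Since \<open>T = e T e\<close>, the upper bound may be used at \<open>e x\<close>. The
  form of \<open>c e - T\<close> then lies between 0 and \<open>c (norm x)^2\<close>, and the form
  of a selfadjoint operator controls its norm.\<close>

lemma norm_jc_reflect:
  assumes T: "T \<in> J" and c: "0 \<le> c" and pos: "\<And>x. 0 \<le> rinner (bop_apply T x) x"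
    and le: "\<And>x. rinner (bop_apply T x) x \<le> c * (norm x)\<^sup>2"
  shows "norm (c *\<^sub>R e - T) \<le> c"
proof (rule norm_le_numerical_radius[OF _ c])
  show "selfadjoint_op (c *\<^sub>R e - T)" using T jc_unit(1) by (intro jc_closed)
  fix x
  let ?ex = "bop_apply e x"
  have "rinner (bop_apply T x) x = rinner (bop_apply T ?ex) ?ex"
    using selfadjoint_op_rinner[OF jc_closed(5)[OF jc_unit(1)], of "bop_apply T x" x] T
    by (simp add: jc_apply_unit flip: bop_apply_simps(4)) (simp add: jc_unit)
  then have "rinner (bop_apply T x) x \<le> c * (norm ?ex)\<^sup>2" using le[of ?ex] by simp
  moreover have "(norm ?ex)\<^sup>2 \<le> (norm x)\<^sup>2" using norm_jc_unit by (intro power_mono) simp_all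
  then have "c * (norm ?ex)\<^sup>2 \<le> c * (norm x)\<^sup>2" using c by (rule mult_left_mono)
  moreover have "rinner (bop_apply (c *\<^sub>R e - T) x) x = c * (norm ?ex)\<^sup>2 - rinner (bop_apply T x) x"
    by (simp add: bop_apply_simps rinner_diff_left rinner_scaleR_left rinner_unit)
  ultimately show "\<bar>rinner (bop_apply (c *\<^sub>R e - T) x) x\<bar> \<le> c * (norm x)\<^sup>2"
    using pos[of x] by linarith
qed

lemma jc_one_plus_square_inv:
  assumes T: "T \<in> J"
  shows "invertible_in J e (e + T * T)"
proof -
  define c where "c = 1 + (norm T)\<^sup>2"
  \<comment> \<open>\<open>e + T * T\<close> is \<open>c (e - n)\<close>, and
    \<open>norm n \<le> (norm T)^2 / c < 1\<close>.\<close>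
  define n where "n = (1 / c) *\<^sub>R ((norm T)\<^sup>2 *\<^sub>R e - T * T)"
  have c: "c > 0" by (simp add: c_def add_pos_nonneg)
  have TT: "T * T \<in> J" using jc_mult T by simp
  have sq: "rinner (bop_apply (T * T) x) x = (norm (bop_apply T x))\<^sup>2" for x
    using selfadjoint_op_rinner[OF jc_closed(5)[OF T], of "bop_apply T x" x]
    by (simp add: rinner_self bop_apply_simps)
  have "norm ((norm T)\<^sup>2 *\<^sub>R e - T * T) \<le> (norm T)\<^sup>2"
  proof (rule norm_jc_reflect[OF TT])
    fix x
    show "rinner (bop_apply (T * T) x) x \<le> (norm T)\<^sup>2 * (norm x)\<^sup>2"
      unfolding sq power_mult_distrib[symmetric] by (intro power_mono norm_bop_apply) simp
  qed (simp_all add: sq)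
  then have n1: "norm n < 1" using c by (simp add: n_def c_def)
  have nJ: "n \<in> J" using jc_closed jc_unit(1) TT by (simp add: n_def)
  have "(times n ^^ k) e \<in> J" for k
  proof (induction k)
    case (Suc k)
    then show ?case
      using jc_mult[of n "(times n ^^ k) e"] funpow_times_commute[of n e k] nJ jc_unit by simp
  qed (simp add: jc_unit)
  then obtain v where v: "v \<in> J" "(e - n) * v = e" "v * (e - n) = e"
    using neumann_series[of e n J] n1 nJ jc_unit J by (auto simp: jc_algebra_def)
  have "c *\<^sub>R (e - n) = e + T * T"
    using c by (simp add: n_def scaleR_diff_right) (simp add: c_def scaleR_add_left)
  then have "e + T * T = c *\<^sub>R (e - n)" by simp
  then show ?thesis
    using v c by (auto simp: invertible_in_def intro!: bexI[of _ "(1 / c) *\<^sub>R v"] jc_closed)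
qed

lemma sa_algebra_jc: "sa_algebra J J e"
  by standard
    (use J in \<open>auto simp: jc_unit jc_mult jc_sandwich jc_one_plus_square_inv jc_algebra_def
      intro: norm_square_selfadjoint_op jc_closed\<close>)

text \<open>One direction is the norm criterion, with quadratic forms bounding
  \<open>norm T e - T\<close>. The other takes a square root \<open>k\<close> of \<open>T\<close>,
  for which the form of \<open>T\<close> at \<open>x\<close> is
  \<open>(norm (k x))^2\<close>.\<close>

lemma positive_op_iff_nonneg:
  assumes T: "T \<in> J"
  shows "positive_op T \<longleftrightarrow> sa_algebra.nonneg J J e T"
proof -
  interpret sa_algebra J J e by (rule sa_algebra_jc)
  note sa = jc_closed(5)[OF T]
  show ?thesis
  proof
    assume "positive_op T"
    then have "norm (norm T *\<^sub>R e - T) \<le> norm T"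
    proof (intro norm_jc_reflect[OF T])
      fix x
      have "rinner (bop_apply T x) x \<le> norm (bop_apply T x) * norm x" by (rule rinner_le)
      also have "\<dots> \<le> norm T * norm x * norm x" by (intro mult_right_mono norm_bop_apply) simp
      finally show "rinner (bop_apply T x) x \<le> norm T * (norm x)\<^sup>2" by (simp add: power2_eq_square mult.assoc)
    qed (simp_all add: positive_op_iff_rinner[OF sa])
    then show "nonneg T" using spectrum_nonneg_iff[OF T order_refl] T by (simp add: nonneg_def)
  next
    assume nn: "nonneg T"
    have "0 \<le> t" if "t \<in> real_spectrum J e T" for t
      using nn that unfolding nonneg_def by force
    then obtain k where k: "k \<in> J" "cfc J e (\<lambda>t. t) T = k * k"
      using cfc_nonneg_square[OF T continuous_on_id] by metis
    then have Tk: "T = k * k" using T by (simp add: cfc_id)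
    have "rinner (bop_apply T x) x = (norm (bop_apply k x))\<^sup>2" for x
      using selfadjoint_op_rinner[OF jc_closed(5)[OF k(1)], of "bop_apply k x" x]
      by (simp add: Tk bop_apply_simps rinner_self)
    then show "positive_op T" by (simp add: positive_op_iff_rinner[OF sa])
  qed
qed

end

theorem theorem2p8:
  fixes \<alpha> \<beta> :: real
  assumes "\<alpha> \<ge> 0" and "\<beta> > 0"
  shows "(\<forall>e A B :: 'a::cstar_algebra.
        algebra_unit e
        \<and> cstar_positive e A \<and> invertible_in UNIV e A \<and> cstar_positive e B \<and> invertible_in UNIV e B
        \<and> cstar_le e (rpow UNIV e A \<beta>) B
        \<longrightarrow>
          cstar_le e (term_I UNIV e \<alpha> \<beta> A B) (term_II UNIV e \<alpha> \<beta> A B)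
        \<and> cstar_le e (term_II UNIV e \<alpha> \<beta> A B) (rel_entropy UNIV e \<alpha> \<beta> A B)
        \<and> cstar_le e (rel_entropy UNIV e \<alpha> \<beta> A B) (term_III UNIV e \<alpha> \<beta> A B)
        \<and> cstar_le e (term_III UNIV e \<alpha> \<beta> A B) (term_V UNIV e \<alpha> \<beta> A B))
    \<and> (\<forall>e A B :: 'b::real_cstar_algebra.
        algebra_unit e
        \<and> real_cstar_positive e A \<and> invertible_in UNIV e A \<and> real_cstar_positive e B \<and> invertible_in UNIV e B
        \<and> real_cstar_le e (rpow UNIV e A \<beta>) B
        \<longrightarrow>
          real_cstar_le e (term_I UNIV e \<alpha> \<beta> A B) (term_II UNIV e \<alpha> \<beta> A B)
        \<and> real_cstar_le e (term_II UNIV e \<alpha> \<beta> A B) (rel_entropy UNIV e \<alpha> \<beta> A B)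
        \<and> real_cstar_le e (rel_entropy UNIV e \<alpha> \<beta> A B) (term_III UNIV e \<alpha> \<beta> A B)
        \<and> real_cstar_le e (term_III UNIV e \<alpha> \<beta> A B) (term_V UNIV e \<alpha> \<beta> A B))
    \<and> (\<forall>(J :: 'h::complex_hilbert_space bop set) e A B.
        jc_algebra J \<and> jordan_unit J e
        \<and> A \<in> J \<and> positive_op A \<and> invertible_in J e A
        \<and> B \<in> J \<and> positive_op B \<and> invertible_in J e B
        \<and> op_le (rpow J e A \<beta>) B
        \<longrightarrow>
          op_le (term_I J e \<alpha> \<beta> A B) (term_II J e \<alpha> \<beta> A B)
        \<and> op_le (term_II J e \<alpha> \<beta> A B) (rel_entropy J e \<alpha> \<beta> A B)
        \<and> op_le (rel_entropy J e \<alpha> \<beta> A B) (term_III J e \<alpha> \<beta> A B)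
        \<and> op_le (term_III J e \<alpha> \<beta> A B) (term_V J e \<alpha> \<beta> A B))"
proof (intro conjI allI impI; elim conjE)
  fix e A B :: 'a
  assume e: "algebra_unit e" and A: "cstar_positive e A" "invertible_in UNIV e A"
    and B: "cstar_positive e B" and le: "cstar_le e (rpow UNIV e A \<beta>) B"
  interpret sa_algebra "{x :: 'a. star x = x}" UNIV e by (rule sa_algebra_cstar[OF e])
  note nonneg = cstar_positive_iff_nonneg[OF e]
  have "B \<in> {x. star x = x}" using B by (simp add: cstar_positive_def)
  note chain = entropy_chain[OF A[unfolded nonneg] this le[unfolded cstar_le_def nonneg], of \<alpha>]
  show "cstar_le e (term_I UNIV e \<alpha> \<beta> A B) (term_II UNIV e \<alpha> \<beta> A B)"
    "cstar_le e (term_II UNIV e \<alpha> \<beta> A B) (rel_entropy UNIV e \<alpha> \<beta> A B)"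
    "cstar_le e (rel_entropy UNIV e \<alpha> \<beta> A B) (term_III UNIV e \<alpha> \<beta> A B)"
    "cstar_le e (term_III UNIV e \<alpha> \<beta> A B) (term_V UNIV e \<alpha> \<beta> A B)"
    unfolding cstar_le_def nonneg by (rule chain)+
next
  fix e A B :: 'b
  assume e: "algebra_unit e" and A: "real_cstar_positive e A" "invertible_in UNIV e A"
    and B: "real_cstar_positive e B" and le: "real_cstar_le e (rpow UNIV e A \<beta>) B"
  interpret sa_algebra "{x :: 'b. star x = x}" UNIV e by (rule sa_algebra_real_cstar[OF e])
  note nonneg = real_cstar_positive_iff_nonneg[OF e]
  have "B \<in> {x. star x = x}" using B by (simp add: real_cstar_positive_def)
  note chain = entropy_chain[OF A[unfolded nonneg] this le[unfolded real_cstar_le_def nonneg], of \<alpha>]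
  show "real_cstar_le e (term_I UNIV e \<alpha> \<beta> A B) (term_II UNIV e \<alpha> \<beta> A B)"
    "real_cstar_le e (term_II UNIV e \<alpha> \<beta> A B) (rel_entropy UNIV e \<alpha> \<beta> A B)"
    "real_cstar_le e (rel_entropy UNIV e \<alpha> \<beta> A B) (term_III UNIV e \<alpha> \<beta> A B)"
    "real_cstar_le e (term_III UNIV e \<alpha> \<beta> A B) (term_V UNIV e \<alpha> \<beta> A B)"
    unfolding real_cstar_le_def nonneg by (rule chain)+
next
  fix J :: "'h bop set" and e A B
  assume J: "jc_algebra J" "jordan_unit J e" and A: "A \<in> J" "positive_op A" "invertible_in J e A"
    and B: "B \<in> J" and le: "op_le (rpow J e A \<beta>) B"
  interpret sa_algebra J J e by (rule sa_algebra_jc[OF J])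
  note iff = positive_op_iff_nonneg[OF J]
  have nA: "nonneg A" using A by (simp add: iff)
  \<comment> \<open>\<open>positive_op\<close> makes sense for every operator, but matches
    \<open>nonneg\<close> only inside \<open>J\<close>, so membership comes first.\<close>
  have "B - rpow J e A \<beta> \<in> J" using B rpow_A_S[OF nA A(3)] by simp
  then have "nonneg (B - rpow J e A \<beta>)" using le by (simp add: op_le_def iff)
  note chain = entropy_chain[OF nA A(3) B this, of \<alpha>]
  have op_leI: "op_le S T" if "nonneg (T - S)" for S T
    using that iff[of "T - S"] by (simp add: op_le_def nonneg_def)
  show "op_le (term_I J e \<alpha> \<beta> A B) (term_II J e \<alpha> \<beta> A B)"
    "op_le (term_II J e \<alpha> \<beta> A B) (rel_entropy J e \<alpha> \<beta> A B)"
    "op_le (rel_entropy J e \<alpha> \<beta> A B) (term_III J e \<alpha> \<beta> A B)"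
    "op_le (term_III J e \<alpha> \<beta> A B) (term_V J e \<alpha> \<beta> A B)"
    by (rule op_leI chain)+
qed

end
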